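(* Let $X$ be a crystal 2-polygraph, $(\alpha,\beta)\in\mathrm{Br}(X)$ a branching, and $k$ a Kashiwara operator such that $k.(\alpha,\beta)\neq0$. Then: (i) $(\alpha,\beta)\in\mathrm{LBr}(X)$ if and only if $k.(\alpha,\beta)\in\mathrm{LBr}(X)$; (ii) $(\alpha,\beta)$ is confluent if and only if $k.(\alpha,\beta)$ is confluent; (iii) $(\alpha,\beta)$ is aspherical (resp. Peiffer) if and only if $k.(\alpha,\beta)$ is aspherical (resp. Peiffer); in particular $(\alpha,\beta)$ is overlapping if and only if $k.(\alpha,\beta)$ is overlapping; (iv) $(\alpha,\beta)\in\mathrm{Crit}(X)$ if and only if $k.(\alpha,\beta)\in\mathrm{Crit}(X)$.
   Context: Crystals. Fix a complex symmetrizable Kac–Moody algebra $\mathfrak g$ with weight lattice $P$, dominant weights $P^+$, simple roots $\alpha_i$ and simple coroots $\alpha_i^\vee$ ($i\in I$). A (normal) crystal is a set $\Gamma$ with maps $\mathrm{wt}:\Gamma\to P$, $\varepsilon_i,\varphi_i:\Gamma\to\mathbb Z$, $e_i,f_i:\Gamma\to\Gamma\sqcup\{0\}$ such that for all $x\in\Gamma$, $i\in I$: $\varphi_i(x)-\varepsilon_i(x)=\langle\mathrm{wt}(x),\alpha_i^\vee\rangle$; $\varepsilon_i(x)=\max\{n:e_i^n.x\ne0\}$ and $\varphi_i(x)=\max\{n:f_i^n.x\neq0\}$; $\mathrm{wt}(e_i.x)=\mathrm{wt}(x)+\alpha_i$ if $e_i.x\ne0$, and $\mathrm{wt}(f_i.x)=\mathrm{wt}(x)-\alpha_i$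 if $f_i.x\neq0$; and $e_i.x=x'$ iff $f_i.x'=x$. The maps $e_i,f_i$ are the Kashiwara operators; $k$ denotes any one of them. A morphism of crystals is a map commuting with $\mathrm{wt},\varepsilon_i,\varphi_i,e_i,f_i$ (with $0\mapsto0$). "Crystal" always means a normal crystal each of whose connected components (under the Kashiwara operators) is isomorphic to the crystal $B(\lambda)$ of the irreducible highest weight module for some $\lambda\in P^+$. The tensor product $\Gamma_1\otimes\Gamma_2$ is $\Gamma_1\times\Gamma_2$ with additive weight, $e_i.(u\otimes v)=(e_i.u)\otimes v$ if $\varphi_i(u)\ge\varepsilon_i(v)$ and $u\otimes(e_i.v)$ otherwise, $f_i.(u\otimes v)=(f_i.u)\otimes v$ if $\varphi_i(u)>\varepsilon_i(v)$ and $u\otimes(f_i.v)$ otherwise (a tensor with a $0$ entry is $0$). The free monoid $\Gamma^*=\bigsqcup_{n\ge0}\Gamma^{\otimes n}$ is a crystal (the empty word has weight $0$ and is killed by all operators). Polygraphs. A 2-polygraph is a pair of sets $X=(X_1,X_2)$ with source and target maps $s_1,t_1:X_2\to X_1^*$. It is a crystal 2-polygraph if $X_1,X_2$ are crystals and $s_1,t_1$ are crystal morphisms. A rewriting step is $t\alpha v:ts_1(\alpha)v\Rightarrow tt_1(\alpha)v$ with $t,v\in X_1^*$, $\alpha\in X_2$. A rewriting sequence is a sequence of composable steps. A branching is a pair of finite rewriting sequences with the same source; $\mathrm{Br}(X)$ is the set of branchings. It is confluent if the targets of its two entries can be rewritten by finite (possibly empty) rewriting sequences to a common word. A local branching is a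 branching whose two entries are rewriting steps; $\mathrm{LBr}(X)$ is the set of these. A local branching is aspherical if of the form $(f,f)$; Peiffer if (up to exchanging entries) of the form $(fv,ug)$ with $f$ a step of source $u$ and $g$ a step of source $v$; the remaining local branchings are overlapping. Order $\mathrm{LBr}(X)$ by the relation generated by $(f,g)\sqsubseteq(ufv,ugv)$ for $u,v\in X_1^*$; a critical branching is an overlapping local branching minimal for $\sqsubseteq$, and $\mathrm{Crit}(X)$ is the set of these. Crystal structure. For a step $\gamma=t\alpha v$, $\mathrm{wt}(\gamma)=\mathrm{wt}(ts_1(\alpha)v)$, and $k.\gamma$ is $(k.t)\alpha v$, $t(k.\alpha)v$, $t\alpha(k.v)$ or $0$ according to whether $k.(ts_1(\alpha)v)$ is $(k.t)s_1(\alpha)v$, $t(k.s_1(\alpha))v$, $ts_1(\alpha)(k.v)$ or $0$. For a rewriting sequence with first word $w_0$ and steps $\gamma_1,\gamma_2,\dots$, its weight is $\mathrm{wt}(w_0)$ and $k$ sends it to $0$ if $k.w_0=0$ and otherwise to the sequence with steps $k.\gamma_1,k.\gamma_2,\dots$ starting at $k.w_0$. For a branching $(\alpha,\beta)$ with source $u$, $\mathrm{wt}(\alpha,\beta)=\mathrm{wt}(u)$, $k.(\alpha,\beta)=(k.\alpha,k.\beta)$ if $k.u\neq0$ and $0$ otherwise. *)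

theory Defs
  imports
    Complex_Main
    "HOL-Computational_Algebra.Polynomial"
    "HOL-Computational_Algebra.Fraction_Field"
    "HOL-Library.Poly_Mapping"
begin

section \<open>Kac--Moody data\<close>

text \<open>
  A symmetrizable Kac--Moody algebra enters only through its Cartan datum, from which the
  quantum group and the crystals \<open>B(\<Lambda>)\<close> below are built.  The weight lattice \<open>P\<close> is the whole
  type \<open>'p\<close>; its dual \<open>P\<^sup>\<or>\<close> consists of the additive maps \<open>'p \<Rightarrow> int\<close>, so a simple coroot is the
  map \<open>\<lambda>\<mu>. \<langle>\<mu>, \<alpha>\<^sub>i\<^sup>\<or>\<rangle>\<close>.  The numbers \<open>symd i\<close> are the diagonal entries of the matrix symmetrizing the
  Cartan matrix.
\<close>

record ('i, 'p) cartan_datum =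
  idx :: "'i set"
  root :: "'i \<Rightarrow> 'p"
  coroot :: "'i \<Rightarrow> 'p \<Rightarrow> int"
  symd :: "'i \<Rightarrow> nat"

definition zmul :: "int \<Rightarrow> 'p::ab_group_add \<Rightarrow> 'p" where
  "zmul n x = (\<Sum>k<nat n. x) - (\<Sum>k<nat (- n). x)"

definition free_of_rank :: "'p::ab_group_add itself \<Rightarrow> nat \<Rightarrow> bool" where
  "free_of_rank _ r \<longleftrightarrow>
    (\<exists>b :: nat \<Rightarrow> 'p. \<forall>x. \<exists>!c :: nat \<Rightarrow> int. (\<forall>k\<ge>r. c k = 0) \<and> x = (\<Sum>k<r. zmul (c k) (b k)))"

definition cartan_entry :: "('i, 'p) cartan_datum \<Rightarrow> 'i \<Rightarrow> 'i \<Rightarrow> int" where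
  "cartan_entry D i j = coroot D i (root D j)"

text \<open>Row rank; independence over the integers is the same as over the rationals.\<close>

definition cartan_rank :: "('i, 'p) cartan_datum \<Rightarrow> nat" where
  "cartan_rank D = Max {card S | S. S \<subseteq> idx D \<and>
    (\<forall>c :: 'i \<Rightarrow> int. (\<forall>j\<in>idx D. (\<Sum>i\<in>S. c i * cartan_entry D i j) = 0) \<longrightarrow> (\<forall>i\<in>S. c i = 0))}"

text \<open>
  The rank condition is \<open>dim \<hh> = 2 |I| - rank A\<close>.  The existence of fundamental weights says that
  the simple coroots are part of a basis of \<open>P\<^sup>\<or>\<close>; it implies their linear independence and makes
  \<open>P\<close> the full weight lattice rather than a proper sublattice such as the root lattice.
\<close>

definition kac_moody_datum :: "('i, 'p::ab_group_add) cartan_datum \<Rightarrow> bool" where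
  "kac_moody_datum D \<longleftrightarrow>
    finite (idx D) \<and>
    free_of_rank TYPE('p) (2 * card (idx D) - cartan_rank D) \<and>
    (\<forall>i\<in>idx D. additive (coroot D i)) \<and>
    (\<forall>c :: 'i \<Rightarrow> int. (\<Sum>i\<in>idx D. zmul (c i) (root D i)) = 0 \<longrightarrow> (\<forall>i\<in>idx D. c i = 0)) \<and>
    (\<forall>i\<in>idx D. \<exists>\<omega>. \<forall>j\<in>idx D. coroot D j \<omega> = (if j = i then 1 else 0)) \<and>
    (\<forall>i\<in>idx D. cartan_entry D i i = 2) \<and>
    (\<forall>i\<in>idx D. \<forall>j\<in>idx D. i \<noteq> j \<longrightarrow>
      cartan_entry D i j \<le> 0 \<and> (cartan_entry D i j = 0 \<longleftrightarrow> cartan_entry D j i = 0)) \<and>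
    (\<forall>i\<in>idx D. 0 < symd D i) \<and>
    (\<forall>i\<in>idx D. \<forall>j\<in>idx D. int (symd D i) * cartan_entry D i j = int (symd D j) * cartan_entry D j i)"

definition dominant :: "('i, 'p) cartan_datum \<Rightarrow> 'p set" where
  "dominant D = {\<Lambda>. \<forall>i\<in>idx D. 0 \<le> coroot D i \<Lambda>}"


section \<open>Normal crystals\<close>

text \<open>The value \<open>None\<close> of an operator plays the role of the extra element \<open>0\<close>.\<close>

record ('a, 'i, 'p) crystal =
  cset :: "'a set"
  wt :: "'a \<Rightarrow> 'p"
  eps :: "'i \<Rightarrow> 'a \<Rightarrow> int"
  phi :: "'i \<Rightarrow> 'a \<Rightarrow> int"
  eop :: "'i \<Rightarrow> 'a \<Rightarrow> 'a option"
  fop :: "'i \<Rightarrow> 'a \<Rightarrow> 'a option"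

primrec opow :: "('a \<Rightarrow> 'a option) \<Rightarrow> nat \<Rightarrow> 'a \<Rightarrow> 'a option" where
  "opow g 0 x = Some x"
| "opow g (Suc n) x = Option.bind (opow g n x) g"

definition is_string_length :: "('a \<Rightarrow> 'a option) \<Rightarrow> 'a \<Rightarrow> int \<Rightarrow> bool" where
  "is_string_length g x m \<longleftrightarrow>
    (\<exists>n. m = int n \<and> opow g n x \<noteq> None \<and> (\<forall>n'. opow g n' x \<noteq> None \<longrightarrow> n' \<le> n))"

definition string_length :: "('a \<Rightarrow> 'a option) \<Rightarrow> 'a \<Rightarrow> int" where
  "string_length g x = (THE m. is_string_length g x m)"

definition normal_crystal ::
  "('i, 'p::ab_group_add) cartan_datum \<Rightarrow> ('a, 'i, 'p) crystal \<Rightarrow> bool" where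
  "normal_crystal D \<Gamma> \<longleftrightarrow>
    (\<forall>i\<in>idx D. \<forall>x\<in>cset \<Gamma>.
      (\<forall>y. eop \<Gamma> i x = Some y \<longrightarrow> y \<in> cset \<Gamma>) \<and>
      (\<forall>y. fop \<Gamma> i x = Some y \<longrightarrow> y \<in> cset \<Gamma>) \<and>
      phi \<Gamma> i x - eps \<Gamma> i x = coroot D i (wt \<Gamma> x) \<and>
      is_string_length (eop \<Gamma> i) x (eps \<Gamma> i x) \<and>
      is_string_length (fop \<Gamma> i) x (phi \<Gamma> i x) \<and>
      (\<forall>y. eop \<Gamma> i x = Some y \<longrightarrow> wt \<Gamma> y = wt \<Gamma> x + root D i) \<and>
      (\<forall>y. fop \<Gamma> i x = Some y \<longrightarrow> wt \<Gamma> y = wt \<Gamma> x - root D i) \<and>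
      (\<forall>y\<in>cset \<Gamma>. eop \<Gamma> i x = Some y \<longleftrightarrow> fop \<Gamma> i y = Some x))"

definition crystal_morphism ::
  "('i, 'p) cartan_datum \<Rightarrow> ('a, 'i, 'p) crystal \<Rightarrow> ('b, 'i, 'p) crystal \<Rightarrow> ('a \<Rightarrow> 'b) \<Rightarrow> bool" where
  "crystal_morphism D \<Gamma> \<Delta> h \<longleftrightarrow>
    (\<forall>x\<in>cset \<Gamma>. h x \<in> cset \<Delta> \<and> wt \<Delta> (h x) = wt \<Gamma> x \<and>
      (\<forall>i\<in>idx D.
        eps \<Delta> i (h x) = eps \<Gamma> i x \<and>
        phi \<Delta> i (h x) = phi \<Gamma> i x \<and>
        eop \<Delta> i (h x) = map_option h (eop \<Gamma> i x) \<and>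
        fop \<Delta> i (h x) = map_option h (fop \<Gamma> i x)))"

definition crystal_isomorphic ::
  "('i, 'p) cartan_datum \<Rightarrow> ('a, 'i, 'p) crystal \<Rightarrow> ('b, 'i, 'p) crystal \<Rightarrow> bool" where
  "crystal_isomorphic D \<Gamma> \<Delta> \<longleftrightarrow>
    (\<exists>h. crystal_morphism D \<Gamma> \<Delta> h \<and> bij_betw h (cset \<Gamma>) (cset \<Delta>))"

definition crystal_edges :: "('i, 'p) cartan_datum \<Rightarrow> ('a, 'i, 'p) crystal \<Rightarrow> ('a \<times> 'a) set" where
  "crystal_edges D \<Gamma> = {(x, y). x \<in> cset \<Gamma> \<and> y \<in> cset \<Gamma> \<and>
    (\<exists>i\<in>idx D. eop \<Gamma> i x = Some y \<or> fop \<Gamma> i x = Some y)}"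

definition component ::
  "('i, 'p) cartan_datum \<Rightarrow> ('a, 'i, 'p) crystal \<Rightarrow> 'a \<Rightarrow> ('a, 'i, 'p) crystal" where
  "component D \<Gamma> x =
    \<Gamma>\<lparr>cset := {y. (x, y) \<in> (crystal_edges D \<Gamma> \<union> (crystal_edges D \<Gamma>)\<inverse>)\<^sup>*}\<rparr>"


section \<open>Irreducible highest weight modules of the quantum group\<close>

text \<open>
  The ground field is \<open>\<rat>(q)\<close>.  Modules are taken to be subspaces of the space with basis the words
  over the index type.  This is no restriction: a highest weight module is spanned by the vectors
  obtained by applying words in the lowering operators to a highest weight vector, so it is
  isomorphic to such a subspace.
\<close>

type_synonym qfield = "rat poly fract"
type_synonym 'i qvec = "'i list \<Rightarrow>\<^sub>0 qfield"

definition qvar :: qfield where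
  "qvar = Fract [:0, 1:] 1"

text \<open>Below, \<open>d\<close> is \<open>symd D i\<close>, so that \<open>q\<^sub>i = q\<^sup>d\<close> and \<open>qint d n\<close> is \<open>[n]\<^sub>i\<close>.\<close>

definition qint :: "nat \<Rightarrow> nat \<Rightarrow> qfield" where
  "qint d n = (qvar powi (int d * int n) - qvar powi (- (int d * int n)))
            / (qvar powi int d - qvar powi (- int d))"

definition qfact :: "nat \<Rightarrow> nat \<Rightarrow> qfield" where
  "qfact d n = (\<Prod>k = 1..n. qint d k)"

definition scl :: "qfield \<Rightarrow> 'i qvec \<Rightarrow> 'i qvec" where
  "scl c v = Poly_Mapping.map ((*) c) v"

definition divpow :: "nat \<Rightarrow> ('i qvec \<Rightarrow> 'i qvec) \<Rightarrow> nat \<Rightarrow> 'i qvec \<Rightarrow> 'i qvec" where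
  "divpow d T n v = scl (1 / qfact d n) ((T ^^ n) v)"

definition qsubspace :: "'i qvec set \<Rightarrow> bool" where
  "qsubspace W \<longleftrightarrow> 0 \<in> W \<and> (\<forall>v\<in>W. \<forall>w\<in>W. v + w \<in> W) \<and> (\<forall>c. \<forall>v\<in>W. scl c v \<in> W)"

definition qlinear_on :: "'i qvec set \<Rightarrow> ('i qvec \<Rightarrow> 'i qvec) \<Rightarrow> bool" where
  "qlinear_on V T \<longleftrightarrow>
    (\<forall>v\<in>V. T v \<in> V) \<and>
    (\<forall>v\<in>V. \<forall>w\<in>V. T (v + w) = T v + T w) \<and>
    (\<forall>c. \<forall>v\<in>V. T (scl c v) = scl c (T v))"

text \<open>\<open>qe i\<close>, \<open>qf i\<close> and \<open>qh h\<close> give the actions of \<open>e\<^sub>i\<close>, \<open>f\<^sub>i\<close> and \<open>q\<^sup>h\<close> with \<open>h \<in> P\<^sup>\<or>\<close>.\<close>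

record ('i, 'p) qmodule =
  vset :: "'i qvec set"
  qe :: "'i \<Rightarrow> 'i qvec \<Rightarrow> 'i qvec"
  qf :: "'i \<Rightarrow> 'i qvec \<Rightarrow> 'i qvec"
  qh :: "('p \<Rightarrow> int) \<Rightarrow> 'i qvec \<Rightarrow> 'i qvec"

definition quantum_serre ::
  "('i, 'p) cartan_datum \<Rightarrow> ('i \<Rightarrow> 'i qvec \<Rightarrow> 'i qvec) \<Rightarrow> 'i qvec \<Rightarrow> bool" where
  "quantum_serre D T v \<longleftrightarrow>
    (\<forall>i\<in>idx D. \<forall>j\<in>idx D. i \<noteq> j \<longrightarrow>
      (let m = nat (1 - cartan_entry D i j) in
       (\<Sum>k\<le>m. scl ((-1) ^ k)
          (divpow (symd D i) (T i) k (T j (divpow (symd D i) (T i) (m - k) v)))) = 0))"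

definition is_qmodule ::
  "('i, 'p::ab_group_add) cartan_datum \<Rightarrow> ('i, 'p) qmodule \<Rightarrow> bool" where
  "is_qmodule D M \<longleftrightarrow>
    qsubspace (vset M) \<and>
    (\<forall>i\<in>idx D. qlinear_on (vset M) (qe M i) \<and> qlinear_on (vset M) (qf M i)) \<and>
    (\<forall>h. additive h \<longrightarrow> qlinear_on (vset M) (qh M h)) \<and>
    (\<forall>v\<in>vset M.
      qh M (\<lambda>_. 0) v = v \<and>
      (\<forall>h h'. additive h \<longrightarrow> additive h' \<longrightarrow> qh M (\<lambda>\<mu>. h \<mu> + h' \<mu>) v = qh M h (qh M h' v)) \<and>
      (\<forall>h. \<forall>i\<in>idx D. additive h \<longrightarrow>
        qh M h (qe M i v) = scl (qvar powi h (root D i)) (qe M i (qh M h v)) \<and>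
        qh M h (qf M i v) = scl (qvar powi (- h (root D i))) (qf M i (qh M h v))) \<and>
      (\<forall>i\<in>idx D. \<forall>j\<in>idx D.
        qe M i (qf M j v) - qf M j (qe M i v) =
          (if i = j then
             scl (1 / (qvar powi int (symd D i) - qvar powi (- int (symd D i))))
               (qh M (\<lambda>\<mu>. int (symd D i) * coroot D i \<mu>) v
                - qh M (\<lambda>\<mu>. - (int (symd D i) * coroot D i \<mu>)) v)
           else 0)) \<and>
      quantum_serre D (qe M) v \<and> quantum_serre D (qf M) v)"

definition weight_space :: "('i, 'p::ab_group_add) qmodule \<Rightarrow> 'p \<Rightarrow> 'i qvec set" where
  "weight_space M \<mu> = {v \<in> vset M. \<forall>h. additive h \<longrightarrow> qh M h v = scl (qvar powi h \<mu>) v}"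

definition irreducible_qmodule ::
  "('i, 'p::ab_group_add) cartan_datum \<Rightarrow> ('i, 'p) qmodule \<Rightarrow> bool" where
  "irreducible_qmodule D M \<longleftrightarrow> is_qmodule D M \<and> vset M \<noteq> {0} \<and>
    (\<forall>W \<subseteq> vset M. qsubspace W \<and>
        (\<forall>v\<in>W. (\<forall>i\<in>idx D. qe M i v \<in> W \<and> qf M i v \<in> W) \<and> (\<forall>h. additive h \<longrightarrow> qh M h v \<in> W))
      \<longrightarrow> W = {0} \<or> W = vset M)"

definition highest_weight_vector ::
  "('i, 'p::ab_group_add) cartan_datum \<Rightarrow> ('i, 'p) qmodule \<Rightarrow> 'p \<Rightarrow> 'i qvec \<Rightarrow> bool" where
  "highest_weight_vector D M \<Lambda> u \<longleftrightarrow>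
    u \<in> weight_space M \<Lambda> \<and> u \<noteq> 0 \<and> (\<forall>i\<in>idx D. qe M i u = 0)"


section \<open>The crystal \<open>B(\<Lambda>)\<close>\<close>

text \<open>
  Kashiwara's operators on an integrable module come from the decomposition of \<open>V\<close> as the direct sum
  of the spaces \<open>f\<^sub>i\<^sup>(\<^sup>n\<^sup>) (ker e\<^sub>i \<inter> V\<^sub>\<nu>)\<close> over \<open>0 \<le> n \<le> \<langle>\<nu>, \<alpha>\<^sub>i\<^sup>\<or>\<rangle>\<close>; they send \<open>f\<^sub>i\<^sup>(\<^sup>n\<^sup>) c\<close> to
  \<open>f\<^sub>i\<^sup>(\<^sup>n\<^sup>-\<^sup>1\<^sup>) c\<close> and to \<open>f\<^sub>i\<^sup>(\<^sup>n\<^sup>+\<^sup>1\<^sup>) c\<close>.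
\<close>

definition string_decomposition ::
  "('i, 'p::ab_group_add) cartan_datum \<Rightarrow> ('i, 'p) qmodule \<Rightarrow> 'i \<Rightarrow> 'i qvec
    \<Rightarrow> (nat \<times> 'p) set \<Rightarrow> (nat \<Rightarrow> 'p \<Rightarrow> 'i qvec) \<Rightarrow> bool" where
  "string_decomposition D M i v S c \<longleftrightarrow>
    finite S \<and>
    (\<forall>(n, \<nu>)\<in>S. int n \<le> coroot D i \<nu> \<and> c n \<nu> \<in> weight_space M \<nu> \<and> qe M i (c n \<nu>) = 0) \<and>
    v = (\<Sum>(n, \<nu>)\<in>S. divpow (symd D i) (qf M i) n (c n \<nu>))"

definition etilde ::
  "('i, 'p::ab_group_add) cartan_datum \<Rightarrow> ('i, 'p) qmodule \<Rightarrow> 'i \<Rightarrow> 'i qvec \<Rightarrow> 'i qvec" where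
  "etilde D M i v = (THE v'. \<exists>S c. string_decomposition D M i v S c \<and>
    v' = (\<Sum>(n, \<nu>)\<in>S. if n = 0 then 0 else divpow (symd D i) (qf M i) (n - 1) (c n \<nu>)))"

definition ftilde ::
  "('i, 'p::ab_group_add) cartan_datum \<Rightarrow> ('i, 'p) qmodule \<Rightarrow> 'i \<Rightarrow> 'i qvec \<Rightarrow> 'i qvec" where
  "ftilde D M i v = (THE v'. \<exists>S c. string_decomposition D M i v S c \<and>
    v' = (\<Sum>(n, \<nu>)\<in>S. divpow (symd D i) (qf M i) (n + 1) (c n \<nu>)))"

text \<open>The rational functions regular at \<open>q = 0\<close>.\<close>

definition regular_at_0 :: "qfield set" where
  "regular_at_0 = {Fract a b | a b. poly b 0 \<noteq> 0}"

definition ftilde_word ::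
  "('i, 'p::ab_group_add) cartan_datum \<Rightarrow> ('i, 'p) qmodule \<Rightarrow> 'i list \<Rightarrow> 'i qvec \<Rightarrow> 'i qvec" where
  "ftilde_word D M w u = foldr (ftilde D M) w u"

text \<open>\<open>L(\<Lambda>)\<close> is the span over \<open>regular_at_0\<close> of the vectors \<open>ftilde_word D M w u\<close>.\<close>

definition crystal_lattice ::
  "('i, 'p::ab_group_add) cartan_datum \<Rightarrow> ('i, 'p) qmodule \<Rightarrow> 'i qvec \<Rightarrow> 'i qvec set" where
  "crystal_lattice D M u = {(\<Sum>w\<in>S. scl (a w) (ftilde_word D M w u)) | S a.
    finite S \<and> S \<subseteq> lists (idx D) \<and> (\<forall>w\<in>S. a w \<in> regular_at_0)}"

text \<open>The class of \<open>v\<close> in \<open>L / qL\<close>.\<close>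

definition qclass :: "'i qvec set \<Rightarrow> 'i qvec \<Rightarrow> 'i qvec set" where
  "qclass L v = {v + scl qvar x | x. x \<in> L}"

text \<open>
  The operator on \<open>L / qL\<close> induced by \<open>T\<close>; the union is over representatives and consists of
  a single class when \<open>T\<close> is additive and maps \<open>L\<close> to \<open>L\<close> and \<open>qL\<close> to \<open>qL\<close>.
\<close>

definition induced_op ::
  "'i qvec set \<Rightarrow> ('i qvec \<Rightarrow> 'i qvec) \<Rightarrow> 'i qvec set \<Rightarrow> 'i qvec set option" where
  "induced_op L T b =
    (let b' = (\<Union>v\<in>b. qclass L (T v)) in if b' = qclass L 0 then None else Some b')"

definition crystal_of_module ::
  "('i, 'p::ab_group_add) cartan_datum \<Rightarrow> ('i, 'p) qmodule \<Rightarrow> 'i qvec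
    \<Rightarrow> ('i qvec set, 'i, 'p) crystal" where
  "crystal_of_module D M u =
    (let L = crystal_lattice D M u;
         e = (\<lambda>i. induced_op L (etilde D M i));
         f = (\<lambda>i. induced_op L (ftilde D M i))
     in \<lparr>cset = {qclass L (ftilde_word D M w u) | w. w \<in> lists (idx D)} - {qclass L 0},
         wt = (\<lambda>b. THE \<mu>. b \<inter> weight_space M \<mu> \<noteq> {}),
         eps = (\<lambda>i. string_length (e i)),
         phi = (\<lambda>i. string_length (f i)),
         eop = e,
         fop = f\<rparr>)"

definition isomorphic_to_B ::
  "('i, 'p::ab_group_add) cartan_datum \<Rightarrow> 'p \<Rightarrow> ('a, 'i, 'p) crystal \<Rightarrow> bool" where
  "isomorphic_to_B D \<Lambda> \<Gamma> \<longleftrightarrow>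
    (\<exists>M u. irreducible_qmodule D M \<and> highest_weight_vector D M \<Lambda> u \<and>
      crystal_isomorphic D \<Gamma> (crystal_of_module D M u))"

definition is_crystal ::
  "('i, 'p::ab_group_add) cartan_datum \<Rightarrow> ('a, 'i, 'p) crystal \<Rightarrow> bool" where
  "is_crystal D \<Gamma> \<longleftrightarrow> normal_crystal D \<Gamma> \<and>
    (\<forall>x\<in>cset \<Gamma>. \<exists>\<Lambda>\<in>dominant D. isomorphic_to_B D \<Lambda> (component D \<Gamma> x))"


section \<open>Tensor products and the free monoid\<close>

definition tensor_e ::
  "('a, 'i, 'p) crystal \<Rightarrow> ('b, 'i, 'p) crystal \<Rightarrow> 'i \<Rightarrow> 'a \<times> 'b \<Rightarrow> ('a \<times> 'b) option" where
  "tensor_e \<Gamma> \<Delta> i = (\<lambda>(u, v).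
    if phi \<Gamma> i u \<ge> eps \<Delta> i v then map_option (\<lambda>u'. (u', v)) (eop \<Gamma> i u)
    else map_option (\<lambda>v'. (u, v')) (eop \<Delta> i v))"

definition tensor_f ::
  "('a, 'i, 'p) crystal \<Rightarrow> ('b, 'i, 'p) crystal \<Rightarrow> 'i \<Rightarrow> 'a \<times> 'b \<Rightarrow> ('a \<times> 'b) option" where
  "tensor_f \<Gamma> \<Delta> i = (\<lambda>(u, v).
    if phi \<Gamma> i u > eps \<Delta> i v then map_option (\<lambda>u'. (u', v)) (fop \<Gamma> i u)
    else map_option (\<lambda>v'. (u, v')) (fop \<Delta> i v))"

text \<open>As the tensor product is again normal, its \<open>eps\<close> and \<open>phi\<close> are determined by its operators.\<close>

definition tensor ::
  "('a, 'i, 'p::ab_group_add) crystal \<Rightarrow> ('b, 'i, 'p) crystal \<Rightarrow> ('a \<times> 'b, 'i, 'p) crystal" where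
  "tensor \<Gamma> \<Delta> =
    \<lparr>cset = cset \<Gamma> \<times> cset \<Delta>,
     wt = (\<lambda>(u, v). wt \<Gamma> u + wt \<Delta> v),
     eps = (\<lambda>i. string_length (tensor_e \<Gamma> \<Delta> i)),
     phi = (\<lambda>i. string_length (tensor_f \<Gamma> \<Delta> i)),
     eop = tensor_e \<Gamma> \<Delta>,
     fop = tensor_f \<Gamma> \<Delta>\<rparr>"

text \<open>Transport of structure along \<open>g\<close>, with inverse \<open>h\<close>.\<close>

definition relabel ::
  "('a \<Rightarrow> 'b) \<Rightarrow> ('b \<Rightarrow> 'a) \<Rightarrow> ('a, 'i, 'p) crystal \<Rightarrow> ('b, 'i, 'p) crystal" where
  "relabel g h \<Gamma> =
    \<lparr>cset = g ` cset \<Gamma>,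
     wt = (\<lambda>y. wt \<Gamma> (h y)),
     eps = (\<lambda>i y. eps \<Gamma> i (h y)),
     phi = (\<lambda>i y. phi \<Gamma> i (h y)),
     eop = (\<lambda>i y. map_option g (eop \<Gamma> i (h y))),
     fop = (\<lambda>i y. map_option g (fop \<Gamma> i (h y)))\<rparr>"

primrec tensor_power ::
  "('a, 'i, 'p::ab_group_add) crystal \<Rightarrow> nat \<Rightarrow> ('a list, 'i, 'p) crystal" where
  "tensor_power \<Gamma> 0 =
    \<lparr>cset = {[]}, wt = (\<lambda>_. 0), eps = (\<lambda>_ _. 0), phi = (\<lambda>_ _. 0),
     eop = (\<lambda>_ _. None), fop = (\<lambda>_ _. None)\<rparr>"
| "tensor_power \<Gamma> (Suc n) =
    relabel (\<lambda>(x, w). x # w) (\<lambda>w. (hd w, tl w)) (tensor \<Gamma> (tensor_power \<Gamma> n))"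

definition free_monoid ::
  "('a, 'i, 'p::ab_group_add) crystal \<Rightarrow> ('a list, 'i, 'p) crystal" where
  "free_monoid \<Gamma> =
    \<lparr>cset = (\<Union>n. cset (tensor_power \<Gamma> n)),
     wt = (\<lambda>w. wt (tensor_power \<Gamma> (length w)) w),
     eps = (\<lambda>i w. eps (tensor_power \<Gamma> (length w)) i w),
     phi = (\<lambda>i w. phi (tensor_power \<Gamma> (length w)) i w),
     eop = (\<lambda>i w. eop (tensor_power \<Gamma> (length w)) i w),
     fop = (\<lambda>i w. fop (tensor_power \<Gamma> (length w)) i w)\<rparr>"

datatype 'i kashiwara = Raise 'i | Lower 'i

definition kashiwara_ops :: "('i, 'p) cartan_datum \<Rightarrow> 'i kashiwara set" where
  "kashiwara_ops D = Raise ` idx D \<union> Lower ` idx D"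

primrec kact :: "('a, 'i, 'p) crystal \<Rightarrow> 'i kashiwara \<Rightarrow> 'a \<Rightarrow> 'a option" where
  "kact \<Gamma> (Raise i) = eop \<Gamma> i"
| "kact \<Gamma> (Lower i) = fop \<Gamma> i"


section \<open>2-polygraphs and branchings\<close>

record ('a, 'b) polygraph =
  gens :: "'a set"
  rules :: "'b set"
  src :: "'b \<Rightarrow> 'a list"
  tgt :: "'b \<Rightarrow> 'a list"

definition polygraph2 :: "('a, 'b) polygraph \<Rightarrow> bool" where
  "polygraph2 X \<longleftrightarrow> (\<forall>\<alpha>\<in>rules X. src X \<alpha> \<in> lists (gens X) \<and> tgt X \<alpha> \<in> lists (gens X))"

text \<open>The triple \<open>(t, \<alpha>, v)\<close> is the step \<open>t\<alpha>v\<close>.\<close>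

type_synonym ('a, 'b) step = "'a list \<times> 'b \<times> 'a list"

definition steps :: "('a, 'b) polygraph \<Rightarrow> ('a, 'b) step set" where
  "steps X = lists (gens X) \<times> rules X \<times> lists (gens X)"

definition step_src :: "('a, 'b) polygraph \<Rightarrow> ('a, 'b) step \<Rightarrow> 'a list" where
  "step_src X = (\<lambda>(t, \<alpha>, v). t @ src X \<alpha> @ v)"

definition step_tgt :: "('a, 'b) polygraph \<Rightarrow> ('a, 'b) step \<Rightarrow> 'a list" where
  "step_tgt X = (\<lambda>(t, \<alpha>, v). t @ tgt X \<alpha> @ v)"

definition whisker :: "'a list \<Rightarrow> ('a, 'b) step \<Rightarrow> 'a list \<Rightarrow> ('a, 'b) step" where
  "whisker u = (\<lambda>(t, \<alpha>, v) w. (u @ t, \<alpha>, v @ w))"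

text \<open>A finite rewriting sequence is given by its first word and its list of steps.\<close>

type_synonym ('a, 'b) rseq = "'a list \<times> ('a, 'b) step list"
type_synonym ('a, 'b) branching = "('a, 'b) rseq \<times> ('a, 'b) rseq"

primrec composable :: "('a, 'b) polygraph \<Rightarrow> 'a list \<Rightarrow> ('a, 'b) step list \<Rightarrow> bool" where
  "composable X w [] \<longleftrightarrow> True"
| "composable X w (\<gamma> # \<gamma>s) \<longleftrightarrow>
    \<gamma> \<in> steps X \<and> step_src X \<gamma> = w \<and> composable X (step_tgt X \<gamma>) \<gamma>s"

definition rseqs :: "('a, 'b) polygraph \<Rightarrow> ('a, 'b) rseq set" where
  "rseqs X = {(w, \<gamma>s). w \<in> lists (gens X) \<and> composable X w \<gamma>s}"

definition rseq_src :: "('a, 'b) rseq \<Rightarrow> 'a list" where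
  "rseq_src p = fst p"

definition rseq_tgt :: "('a, 'b) polygraph \<Rightarrow> ('a, 'b) rseq \<Rightarrow> 'a list" where
  "rseq_tgt X = (\<lambda>(w, \<gamma>s). if \<gamma>s = [] then w else step_tgt X (last \<gamma>s))"

definition Br :: "('a, 'b) polygraph \<Rightarrow> ('a, 'b) branching set" where
  "Br X = {(p, p'). p \<in> rseqs X \<and> p' \<in> rseqs X \<and> rseq_src p = rseq_src p'}"

definition Confl :: "('a, 'b) polygraph \<Rightarrow> ('a, 'b) branching set" where
  "Confl X = {(p, p') \<in> Br X. \<exists>r\<in>rseqs X. \<exists>r'\<in>rseqs X.
    rseq_src r = rseq_tgt X p \<and> rseq_src r' = rseq_tgt X p' \<and> rseq_tgt X r = rseq_tgt X r'}"

definition single_step :: "('a, 'b) polygraph \<Rightarrow> ('a, 'b) step \<Rightarrow> ('a, 'b) rseq" where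
  "single_step X \<gamma> = (step_src X \<gamma>, [\<gamma>])"

definition LBr :: "('a, 'b) polygraph \<Rightarrow> ('a, 'b) branching set" where
  "LBr X = {(single_step X f, single_step X g) | f g.
    f \<in> steps X \<and> g \<in> steps X \<and> step_src X f = step_src X g}"

definition Aspherical :: "('a, 'b) polygraph \<Rightarrow> ('a, 'b) branching set" where
  "Aspherical X = {(single_step X f, single_step X f) | f. f \<in> steps X}"

definition Peiffer :: "('a, 'b) polygraph \<Rightarrow> ('a, 'b) branching set" where
  "Peiffer X = {(p, p'). \<exists>f\<in>steps X. \<exists>g\<in>steps X.
    let fv = single_step X (whisker [] f (step_src X g));
        ug = single_step X (whisker (step_src X f) g [])
    in (p, p') = (fv, ug) \<or> (p, p') = (ug, fv)}"

definition Overlapping :: "('a, 'b) polygraph \<Rightarrow> ('a, 'b) branching set" where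
  "Overlapping X = LBr X - Aspherical X - Peiffer X"

definition context_order :: "('a, 'b) polygraph \<Rightarrow> ('a, 'b) branching rel" where
  "context_order X = 
    {((single_step X f, single_step X g),
      (single_step X (whisker u f v), single_step X (whisker u g v))) | f g u v.
      (single_step X f, single_step X g) \<in> LBr X \<and> u \<in> lists (gens X) \<and> v \<in> lists (gens X)}\<^sup>*"

definition Crit :: "('a, 'b) polygraph \<Rightarrow> ('a, 'b) branching set" where
  "Crit X = {b \<in> Overlapping X. \<forall>b'\<in>LBr X. (b', b) \<in> context_order X \<longrightarrow> b' = b}"


section \<open>Crystal 2-polygraphs\<close>

definition crystal_polygraph ::
  "('i, 'p::ab_group_add) cartan_datum \<Rightarrow> ('a, 'b) polygraph
    \<Rightarrow> ('a, 'i, 'p) crystal \<Rightarrow> ('b, 'i, 'p) crystal \<Rightarrow> bool" where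
  "crystal_polygraph D X \<Gamma>\<^sub>1 \<Gamma>\<^sub>2 \<longleftrightarrow>
    polygraph2 X \<and>
    is_crystal D \<Gamma>\<^sub>1 \<and> cset \<Gamma>\<^sub>1 = gens X \<and>
    is_crystal D \<Gamma>\<^sub>2 \<and> cset \<Gamma>\<^sub>2 = rules X \<and>
    crystal_morphism D \<Gamma>\<^sub>2 (free_monoid \<Gamma>\<^sub>1) (src X) \<and>
    crystal_morphism D \<Gamma>\<^sub>2 (free_monoid \<Gamma>\<^sub>1) (tgt X)"

text \<open>
  The case distinction is unambiguous: operators on words preserve length and change the weight,
  so at most one of the three displayed words is the image of \<open>w\<close>.
\<close>

definition kact_step ::
  "('a, 'b) polygraph \<Rightarrow> ('a, 'i, 'p::ab_group_add) crystal \<Rightarrow> ('b, 'i, 'p) crystal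
    \<Rightarrow> 'i kashiwara \<Rightarrow> ('a, 'b) step \<Rightarrow> ('a, 'b) step option" where
  "kact_step X \<Gamma>\<^sub>1 \<Gamma>\<^sub>2 k = (\<lambda>(t, \<alpha>, v).
    let K = kact (free_monoid \<Gamma>\<^sub>1) k;
        s = src X \<alpha>;
        kw = K (t @ s @ v)
    in if kw = None then None
       else if kw = map_option (\<lambda>t'. t' @ s @ v) (K t)
         then map_option (\<lambda>t'. (t', \<alpha>, v)) (K t)
       else if kw = map_option (\<lambda>s'. t @ s' @ v) (K s)
         then map_option (\<lambda>\<alpha>'. (t, \<alpha>', v)) (kact \<Gamma>\<^sub>2 k \<alpha>)
       else if kw = map_option (\<lambda>v'. t @ s @ v') (K v)
         then map_option (\<lambda>v'. (t, \<alpha>, v')) (K v)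
       else None)"

definition kact_rseq ::
  "('a, 'b) polygraph \<Rightarrow> ('a, 'i, 'p::ab_group_add) crystal \<Rightarrow> ('b, 'i, 'p) crystal
    \<Rightarrow> 'i kashiwara \<Rightarrow> ('a, 'b) rseq \<Rightarrow> ('a, 'b) rseq option" where
  "kact_rseq X \<Gamma>\<^sub>1 \<Gamma>\<^sub>2 k = (\<lambda>(w, \<gamma>s).
    case kact (free_monoid \<Gamma>\<^sub>1) k w of
      None \<Rightarrow> None
    | Some w' \<Rightarrow> map_option (Pair w') (those (map (kact_step X \<Gamma>\<^sub>1 \<Gamma>\<^sub>2 k) \<gamma>s)))"

definition kact_branching ::
  "('a, 'b) polygraph \<Rightarrow> ('a, 'i, 'p::ab_group_add) crystal \<Rightarrow> ('b, 'i, 'p) crystal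
    \<Rightarrow> 'i kashiwara \<Rightarrow> ('a, 'b) branching \<Rightarrow> ('a, 'b) branching option" where
  "kact_branching X \<Gamma>\<^sub>1 \<Gamma>\<^sub>2 k = (\<lambda>(p, p').
    if kact (free_monoid \<Gamma>\<^sub>1) k (rseq_src p) = None then None
    else case (kact_rseq X \<Gamma>\<^sub>1 \<Gamma>\<^sub>2 k p, kact_rseq X \<Gamma>\<^sub>1 \<Gamma>\<^sub>2 k p') of
        (Some r, Some r') \<Rightarrow> Some (r, r')
      | _ \<Rightarrow> None)"

end

theory Submission
  imports Defs
begin

text \<open>
  By associativity of the tensor product rule, a Kashiwara operator acts on a concatenation
  \<open>t s v\<close> of words by changing exactly one block, and which one depends only on the numbers
  \<open>\<epsilon>\<^sub>i\<close> and \<open>\<phi>\<^sub>i\<close> of the blocks.  As the source and the target of a rule are crystal morphisms,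
  they have the same \<open>\<epsilon>\<^sub>i\<close> and \<open>\<phi>\<^sub>i\<close>, so the operator changes the same block on both sides of a
  step; hence it sends steps to steps and sequences to sequences, is inverted by the opposite
  operator, and on a whiskered step changes either the step or one of the two contexts.  Each
  property is therefore preserved by every operator, and the opposite operator gives the converse.
\<close>

section \<open>String data\<close>

text \<open>The maxima that define \<open>eps\<close> and \<open>phi\<close> are awkward for tensor
  products, so they are first traded for local conditions on single arrows and recovered by counting
  down along a string. A second obstacle is that \<open>kact_step\<close> recognises the changed
  block by comparing words, trying the left block, then the rule, then the right block. That the
  first match is the right one rests on two facts: operators preserve the length of a word, and they
  fix no word. The same two facts identify the changed block when one word is cut in two ways, as
  happens for a step inside a larger context. Minimality of a critical branching asks about all
  branchings below the image, so there the opposite operator comes first: it carries a comparison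
  below the image back to one below the original.\<close>

lemma opow_Suc_left: "opow g (Suc n) x = Option.bind (g x) (opow g n)"
proof (induction n)
  case (Suc n)
  then show ?case by (cases "g x") simp_all
qed (cases "g x"; simp)

lemma is_string_length_unique:
  "is_string_length g x m \<Longrightarrow> is_string_length g x m' \<Longrightarrow> m = m'"
  unfolding is_string_length_def by (metis order_antisym)

lemma string_length_eqI: "is_string_length g x m \<Longrightarrow> string_length g x = m"
  unfolding string_length_def by (blast intro: the_equality is_string_length_unique)

lemma is_string_length_None: "g x = None \<Longrightarrow> is_string_length g x 0"
proof -
  assume "g x = None"
  then have "n' \<le> 0" if "opow g n' x \<noteq> None" for n'
    using that by (cases n') (auto simp: opow_Suc_left simp del: opow.simps(2))
  then show ?thesis unfolding is_string_length_def by (intro exI[of _ 0]) simp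
qed

lemma is_string_length_Some:
  assumes "g x = Some y" and "is_string_length g y m"
  shows "is_string_length g x (m + 1)"
proof -
  obtain n where n: "m = int n" "opow g n y \<noteq> None" "\<And>n'. opow g n' y \<noteq> None \<Longrightarrow> n' \<le> n"
    using assms(2) unfolding is_string_length_def by blast
  have "n' \<le> Suc n" if "opow g n' x \<noteq> None" for n'
    using that n(3) assms(1) by (cases n') (auto simp: opow_Suc_left simp del: opow.simps(2))
  then show ?thesis
    unfolding is_string_length_def using n(1,2) assms(1)
    by (intro exI[of _ "Suc n"]) (simp add: opow_Suc_left del: opow.simps(2))
qed

text \<open>Only one of the two directions, so that an argument about strings can be made once and
  reused with \<open>E\<close>, \<open>F\<close> and \<open>ep\<close>, \<open>ph\<close> exchanged.
  All conditions concern a single arrow, which makes them easy to check on a tensor product.\<close>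

definition half_string_data ::
  "'a set \<Rightarrow> ('a \<Rightarrow> 'a option) \<Rightarrow> ('a \<Rightarrow> 'a option) \<Rightarrow> ('a \<Rightarrow> int) \<Rightarrow> ('a \<Rightarrow> int) \<Rightarrow> bool" where
  "half_string_data S E F ep ph \<longleftrightarrow>
    (\<forall>x\<in>S. 0 \<le> ep x \<and> (E x = None \<longleftrightarrow> ep x = 0) \<and>
      (\<forall>y. E x = Some y \<longrightarrow> y \<in> S \<and> F y = Some x \<and> ep y = ep x - 1 \<and> ph y = ph x + 1))"

text \<open>The weight-free part of normality for a single index.\<close>

definition string_data ::
  "'a set \<Rightarrow> ('a \<Rightarrow> 'a option) \<Rightarrow> ('a \<Rightarrow> 'a option) \<Rightarrow> ('a \<Rightarrow> int) \<Rightarrow> ('a \<Rightarrow> int) \<Rightarrow> bool" where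
  "string_data S E F ep ph \<longleftrightarrow> half_string_data S E F ep ph \<and> half_string_data S F E ph ep"

lemma half_string_dataD:
  assumes "half_string_data S E F ep ph" and "x \<in> S"
  shows "0 \<le> ep x" and "E x = None \<longleftrightarrow> ep x = 0"
    and "E x = Some y \<Longrightarrow> y \<in> S" and "E x = Some y \<Longrightarrow> F y = Some x"
    and "E x = Some y \<Longrightarrow> ep y = ep x - 1" and "E x = Some y \<Longrightarrow> ph y = ph x + 1"
  using assms unfolding half_string_data_def by simp_all

lemma string_dataD:
  assumes "string_data S E F ep ph" and "x \<in> S"
  shows "0 \<le> ep x" and "E x = None \<longleftrightarrow> ep x = 0"
    and "E x = Some y \<Longrightarrow> y \<in> S" and "E x = Some y \<Longrightarrow> F y = Some x"
    and "E x = Some y \<Longrightarrow> ep y = ep x - 1" and "E x = Some y \<Longrightarrow> ph y = ph x + 1"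
    and "0 \<le> ph x" and "F x = None \<longleftrightarrow> ph x = 0"
    and "F x = Some y \<Longrightarrow> y \<in> S" and "F x = Some y \<Longrightarrow> E y = Some x"
    and "F x = Some y \<Longrightarrow> ph y = ph x - 1" and "F x = Some y \<Longrightarrow> ep y = ep x + 1"
  using assms unfolding string_data_def by (blast dest: half_string_dataD)+

text \<open>\<open>ep\<close> drops by one with each application of \<open>E\<close> and vanishes
  exactly where \<open>E\<close> is undefined, so it counts the remaining applications; hence the
  induction on its value.\<close>

lemma half_string_data_is_string_length:
  assumes "half_string_data S E F ep ph" and "x \<in> S"
  shows "is_string_length E x (ep x)"
  using assms(2)
proof (induction "nat (ep x)" arbitrary: x)
  case 0
  then have "ep x = 0" "E x = None"
    using assms(1) unfolding half_string_data_def by (metis nat_eq_iff2 order_antisym nat_0_iff)+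
  then show ?case by (simp add: is_string_length_None)
next
  case (Suc n)
  then obtain y where y: "E x = Some y"
    using assms(1) unfolding half_string_data_def by fastforce
  then have "y \<in> S" "ep x = ep y + 1"
    using assms(1) Suc.prems unfolding half_string_data_def by auto
  then show ?case
    using is_string_length_Some[of E, OF y, of "ep y"] Suc.hyps by simp
qed

text \<open>Along an arrow of \<open>eop\<close> the value of \<open>eps\<close> drops because
  string lengths are unique. The rise of \<open>phi\<close> comes from reading the same arrow
  backwards as an arrow of \<open>fop\<close>, whose string is one longer at its start.\<close>

lemma normal_crystal_string_data:
  assumes "normal_crystal D \<Gamma>" and "i \<in> idx D"
  shows "string_data (cset \<Gamma>) (eop \<Gamma> i) (fop \<Gamma> i) (eps \<Gamma> i) (phi \<Gamma> i)"
proof -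
  have nc: "(\<forall>y. eop \<Gamma> i x = Some y \<longrightarrow> y \<in> cset \<Gamma>)" "(\<forall>y. fop \<Gamma> i x = Some y \<longrightarrow> y \<in> cset \<Gamma>)"
    "is_string_length (eop \<Gamma> i) x (eps \<Gamma> i x)" "is_string_length (fop \<Gamma> i) x (phi \<Gamma> i x)"
    "(\<forall>y\<in>cset \<Gamma>. eop \<Gamma> i x = Some y \<longleftrightarrow> fop \<Gamma> i y = Some x)" if "x \<in> cset \<Gamma>" for x
    using assms that unfolding normal_crystal_def by blast+
  have e: "eps \<Gamma> i x = eps \<Gamma> i y + 1" if "x \<in> cset \<Gamma>" "eop \<Gamma> i x = Some y" for x y
    using is_string_length_unique[OF nc(3) is_string_length_Some[of "eop \<Gamma> i", OF that(2)]]
      nc(1,3) that by blast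
  have f: "phi \<Gamma> i x = phi \<Gamma> i y + 1" if "x \<in> cset \<Gamma>" "fop \<Gamma> i x = Some y" for x y
    using is_string_length_unique[OF nc(4) is_string_length_Some[of "fop \<Gamma> i", OF that(2)]]
      nc(2,4) that by blast
  have pos: "0 \<le> eps \<Gamma> i x" "0 \<le> phi \<Gamma> i x" if "x \<in> cset \<Gamma>" for x
    using nc(3,4)[OF that] unfolding is_string_length_def by auto
  have e0: "eop \<Gamma> i x = None \<longleftrightarrow> eps \<Gamma> i x = 0" if x: "x \<in> cset \<Gamma>" for x
  proof (cases "eop \<Gamma> i x")
    case None
    then show ?thesis
      using is_string_length_unique[OF nc(3)[OF x] is_string_length_None[of "eop \<Gamma> i"]] by simp
  next
    case (Some y)
    then show ?thesis using e[OF x Some] pos(1)[of y] nc(1)[OF x] by auto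
  qed
  have f0: "fop \<Gamma> i x = None \<longleftrightarrow> phi \<Gamma> i x = 0" if x: "x \<in> cset \<Gamma>" for x
  proof (cases "fop \<Gamma> i x")
    case None
    then show ?thesis
      using is_string_length_unique[OF nc(4)[OF x] is_string_length_None[of "fop \<Gamma> i"]] by simp
  next
    case (Some y)
    then show ?thesis using f[OF x Some] pos(2)[of y] nc(2)[OF x] by auto
  qed
  show ?thesis
    unfolding string_data_def half_string_data_def
  proof (intro conjI ballI allI impI)
    fix x y assume x: "x \<in> cset \<Gamma>" and y: "eop \<Gamma> i x = Some y"
    show "y \<in> cset \<Gamma>" using nc(1)[OF x] y by blast
    then show inv: "fop \<Gamma> i y = Some x" using nc(5)[OF x] y by blast
    show "eps \<Gamma> i y = eps \<Gamma> i x - 1" using e[OF x y] by simp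
    show "phi \<Gamma> i y = phi \<Gamma> i x + 1" using f[OF \<open>y \<in> cset \<Gamma>\<close> inv] .
  next
    fix x y assume x: "x \<in> cset \<Gamma>" and y: "fop \<Gamma> i x = Some y"
    show "y \<in> cset \<Gamma>" using nc(2)[OF x] y by blast
    then show inv: "eop \<Gamma> i y = Some x" using nc(5)[of y] x y by blast
    show "phi \<Gamma> i y = phi \<Gamma> i x - 1" using f[OF x y] by simp
    show "eps \<Gamma> i y = eps \<Gamma> i x + 1" using e[OF \<open>y \<in> cset \<Gamma>\<close> inv] .
  qed (use pos e0 f0 in blast)+
qed

text \<open>The formulas count what is left after the f-arrows at \<open>u\<close> cancel in pairs
  against the e-arrows at \<open>v\<close>. The two tests of the rule differ exactly at equality,
  and this makes the operators inverse: an operator acting on one factor shifts a number by one,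
  after which the opposite test selects the same factor.\<close>

lemma tensor_string_data:
  assumes "string_data (cset \<Gamma>) (eop \<Gamma> i) (fop \<Gamma> i) (eps \<Gamma> i) (phi \<Gamma> i)"
    and "string_data (cset \<Delta>) (eop \<Delta> i) (fop \<Delta> i) (eps \<Delta> i) (phi \<Delta> i)"
  shows "string_data (cset \<Gamma> \<times> cset \<Delta>) (tensor_e \<Gamma> \<Delta> i) (tensor_f \<Gamma> \<Delta> i)
    (\<lambda>(u, v). eps \<Gamma> i u + max 0 (eps \<Delta> i v - phi \<Gamma> i u))
    (\<lambda>(u, v). phi \<Delta> i v + max 0 (phi \<Gamma> i u - eps \<Delta> i v))"
proof -
  note G = string_dataD[OF assms(1)] and H = string_dataD[OF assms(2)]
  show ?thesis
    unfolding string_data_def half_string_data_def tensor_e_def tensor_f_def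
  proof (intro conjI ballI; elim SigmaE; hypsubst; unfold prod.case)
    fix u v assume uv: "u \<in> cset \<Gamma>" "v \<in> cset \<Delta>"
    let ?e = "if eps \<Delta> i v \<le> phi \<Gamma> i u then map_option (\<lambda>u'. (u', v)) (eop \<Gamma> i u)
      else map_option (Pair u) (eop \<Delta> i v)"
    let ?f = "if eps \<Delta> i v < phi \<Gamma> i u then map_option (\<lambda>u'. (u', v)) (fop \<Gamma> i u)
      else map_option (Pair u) (fop \<Delta> i v)"
    show "0 \<le> eps \<Gamma> i u + max 0 (eps \<Delta> i v - phi \<Gamma> i u)"
      "0 \<le> phi \<Delta> i v + max 0 (phi \<Gamma> i u - eps \<Delta> i v)"
      using G(1)[OF uv(1)] H(7)[OF uv(2)] by auto
    \<comment> \<open>If \<open>eop\<close> is sent to \<open>v\<close>, then \<open>eps\<close> of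
      \<open>v\<close> exceeds \<open>phi\<close> of \<open>u\<close>, hence is positive and the
      result is defined; so only \<open>u\<close> can make it undefined. For \<open>fop\<close> the
      roles of \<open>u\<close> and \<open>v\<close> are exchanged.\<close>
    show "(?e = None) = (eps \<Gamma> i u + max 0 (eps \<Delta> i v - phi \<Gamma> i u) = 0)"
      "(?f = None) = (phi \<Delta> i v + max 0 (phi \<Gamma> i u - eps \<Delta> i v) = 0)"
      using G(1,2,7,8)[OF uv(1)] H(1,2,7,8)[OF uv(2)] by auto
  next
    fix u v assume uv: "u \<in> cset \<Gamma>" "v \<in> cset \<Delta>"
    show "\<forall>y. (if eps \<Delta> i v \<le> phi \<Gamma> i u then map_option (\<lambda>u'. (u', v)) (eop \<Gamma> i u)
      else map_option (Pair u) (eop \<Delta> i v)) = Some y \<longrightarrow>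
      y \<in> cset \<Gamma> \<times> cset \<Delta> \<and>
      (case y of (u, v) \<Rightarrow> if eps \<Delta> i v < phi \<Gamma> i u then map_option (\<lambda>u'. (u', v)) (fop \<Gamma> i u)
        else map_option (Pair u) (fop \<Delta> i v)) = Some (u, v) \<and>
      (case y of (u, v) \<Rightarrow> eps \<Gamma> i u + max 0 (eps \<Delta> i v - phi \<Gamma> i u)) =
        eps \<Gamma> i u + max 0 (eps \<Delta> i v - phi \<Gamma> i u) - 1 \<and>
      (case y of (u, v) \<Rightarrow> phi \<Delta> i v + max 0 (phi \<Gamma> i u - eps \<Delta> i v)) =
        phi \<Delta> i v + max 0 (phi \<Gamma> i u - eps \<Delta> i v) + 1"
      using G(3-6)[OF uv(1)] H(3-6)[OF uv(2)] uv by (auto simp: max_def)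
    show "\<forall>y. (if eps \<Delta> i v < phi \<Gamma> i u then map_option (\<lambda>u'. (u', v)) (fop \<Gamma> i u)
      else map_option (Pair u) (fop \<Delta> i v)) = Some y \<longrightarrow>
      y \<in> cset \<Gamma> \<times> cset \<Delta> \<and>
      (case y of (u, v) \<Rightarrow> if eps \<Delta> i v \<le> phi \<Gamma> i u then map_option (\<lambda>u'. (u', v)) (eop \<Gamma> i u)
        else map_option (Pair u) (eop \<Delta> i v)) = Some (u, v) \<and>
      (case y of (u, v) \<Rightarrow> phi \<Delta> i v + max 0 (phi \<Gamma> i u - eps \<Delta> i v)) =
        phi \<Delta> i v + max 0 (phi \<Gamma> i u - eps \<Delta> i v) - 1 \<and>
      (case y of (u, v) \<Rightarrow> eps \<Gamma> i u + max 0 (eps \<Delta> i v - phi \<Gamma> i u)) =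
        eps \<Gamma> i u + max 0 (eps \<Delta> i v - phi \<Gamma> i u) + 1"
      using G(9-12)[OF uv(1)] H(9-12)[OF uv(2)] uv by (auto simp: max_def)
  qed
qed

section \<open>The free monoid\<close>

lemma cset_tensor_power: "cset (tensor_power \<Gamma> n) = {w \<in> lists (cset \<Gamma>). length w = n}"
proof (induction n)
  case (Suc n)
  show ?case
  proof (rule set_eqI)
    fix w show "w \<in> cset (tensor_power \<Gamma> (Suc n)) \<longleftrightarrow> w \<in> {w \<in> lists (cset \<Gamma>). length w = Suc n}"
      using Suc by (cases w) (auto simp: relabel_def tensor_def)
  qed
qed auto

context
  fixes \<Gamma> :: "('a, 'i, 'p::ab_group_add) crystal" and i :: 'i
  assumes str: "string_data (cset \<Gamma>) (eop \<Gamma> i) (fop \<Gamma> i) (eps \<Gamma> i) (phi \<Gamma> i)"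
begin

text \<open>\<open>tensor\<close> defines its \<open>eps\<close> and \<open>phi\<close> as string
  lengths of its operators. The closed formulas satisfy the local conditions, which identifies them
  with those lengths; the recursion on the first letter follows.\<close>

lemma tensor_power_Suc_string_data:
  assumes "string_data (cset (tensor_power \<Gamma> n)) (eop (tensor_power \<Gamma> n) i)
    (fop (tensor_power \<Gamma> n) i) (eps (tensor_power \<Gamma> n) i) (phi (tensor_power \<Gamma> n) i)"
  shows "string_data (cset (tensor_power \<Gamma> (Suc n))) (eop (tensor_power \<Gamma> (Suc n)) i)
    (fop (tensor_power \<Gamma> (Suc n)) i) (eps (tensor_power \<Gamma> (Suc n)) i)
    (phi (tensor_power \<Gamma> (Suc n)) i)" (is ?data)
    and "x \<in> cset \<Gamma> \<Longrightarrow> w \<in> cset (tensor_power \<Gamma> n) \<Longrightarrow>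
    eps (tensor_power \<Gamma> (Suc n)) i (x # w)
      = eps \<Gamma> i x + max 0 (eps (tensor_power \<Gamma> n) i w - phi \<Gamma> i x)"
    and "x \<in> cset \<Gamma> \<Longrightarrow> w \<in> cset (tensor_power \<Gamma> n) \<Longrightarrow>
    phi (tensor_power \<Gamma> (Suc n)) i (x # w)
      = phi (tensor_power \<Gamma> n) i w + max 0 (phi \<Gamma> i x - eps (tensor_power \<Gamma> n) i w)"
proof -
  let ?T = "tensor_power \<Gamma> n"
  have t: "string_data (cset \<Gamma> \<times> cset ?T) (tensor_e \<Gamma> ?T i) (tensor_f \<Gamma> ?T i)
    (\<lambda>(u, v). eps \<Gamma> i u + max 0 (eps ?T i v - phi \<Gamma> i u))
    (\<lambda>(u, v). phi ?T i v + max 0 (phi \<Gamma> i u - eps ?T i v))"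
    by (rule tensor_string_data[OF str assms])
  then have len: "string_length (tensor_e \<Gamma> ?T i) (x, w)
      = eps \<Gamma> i x + max 0 (eps ?T i w - phi \<Gamma> i x)"
    "string_length (tensor_f \<Gamma> ?T i) (x, w)
      = phi ?T i w + max 0 (phi \<Gamma> i x - eps ?T i w)"
    if "x \<in> cset \<Gamma>" "w \<in> cset ?T" for x w
    using that half_string_data_is_string_length[of "cset \<Gamma> \<times> cset ?T", THEN string_length_eqI,
        of _ _ _ _ "(x, w)"]
    unfolding string_data_def by fastforce+
  show "x \<in> cset \<Gamma> \<Longrightarrow> w \<in> cset (tensor_power \<Gamma> n) \<Longrightarrow>
    eps (tensor_power \<Gamma> (Suc n)) i (x # w)
      = eps \<Gamma> i x + max 0 (eps (tensor_power \<Gamma> n) i w - phi \<Gamma> i x)"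
    by (simp add: relabel_def tensor_def len)
  show "x \<in> cset \<Gamma> \<Longrightarrow> w \<in> cset (tensor_power \<Gamma> n) \<Longrightarrow>
    phi (tensor_power \<Gamma> (Suc n)) i (x # w)
      = phi (tensor_power \<Gamma> n) i w + max 0 (phi \<Gamma> i x - eps (tensor_power \<Gamma> n) i w)"
    by (simp add: relabel_def tensor_def len)
  \<comment> \<open>Transport along the bijection from pairs to nonempty words. \<open>ep'\<close>
    and \<open>ph'\<close> have to agree with \<open>ep\<close> and \<open>ph\<close> on
    \<open>S\<close> only, since the string lengths are known to equal the formulas only on
    \<open>cset\<close>.\<close>
  have "half_string_data ((\<lambda>(x, w). x # w) ` S)
      (\<lambda>y. map_option (\<lambda>(x, w). x # w) (E (hd y, tl y)))
      (\<lambda>y. map_option (\<lambda>(x, w). x # w) (F (hd y, tl y)))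
      (\<lambda>y. ep' (hd y, tl y)) (\<lambda>y. ph' (hd y, tl y))"
    if "half_string_data S E F ep ph" "\<And>p. p \<in> S \<Longrightarrow> ep' p = ep p" "\<And>p. p \<in> S \<Longrightarrow> ph' p = ph p"
    for S :: "('a \<times> 'a list) set" and E F ep ph ep' ph'
    using that unfolding half_string_data_def by (fastforce split: prod.splits)
  note relabelled = this[of "cset \<Gamma> \<times> cset ?T"]
  have "half_string_data (cset (tensor_power \<Gamma> (Suc n))) (eop (tensor_power \<Gamma> (Suc n)) i)
    (fop (tensor_power \<Gamma> (Suc n)) i) (eps (tensor_power \<Gamma> (Suc n)) i)
    (phi (tensor_power \<Gamma> (Suc n)) i)"
    using t unfolding string_data_def tensor_power.simps relabel_def tensor_def crystal.simps
    by (elim conjE, intro relabelled) (assumption, auto simp: len)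
  moreover have "half_string_data (cset (tensor_power \<Gamma> (Suc n))) (fop (tensor_power \<Gamma> (Suc n)) i)
    (eop (tensor_power \<Gamma> (Suc n)) i) (phi (tensor_power \<Gamma> (Suc n)) i)
    (eps (tensor_power \<Gamma> (Suc n)) i)"
    using t unfolding string_data_def tensor_power.simps relabel_def tensor_def crystal.simps
    by (elim conjE, intro relabelled) (assumption, auto simp: len)
  ultimately show ?data unfolding string_data_def ..
qed

lemma tensor_power_string_data:
  "string_data (cset (tensor_power \<Gamma> n)) (eop (tensor_power \<Gamma> n) i)
    (fop (tensor_power \<Gamma> n) i) (eps (tensor_power \<Gamma> n) i) (phi (tensor_power \<Gamma> n) i)"
proof (induction n)
  case 0
  show ?case by (simp add: string_data_def half_string_data_def)
next
  case (Suc n)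
  then show ?case by (rule tensor_power_Suc_string_data)
qed

text \<open>\<open>free_monoid\<close> selects the tensor power by the length of the word at hand.
  Facts about an image word therefore need its length first; it comes from the closure part of the
  string data, applied to the words of one length.\<close>

lemma free_monoid_string_data:
  "string_data (lists (cset \<Gamma>)) (eop (free_monoid \<Gamma>) i) (fop (free_monoid \<Gamma>) i)
    (eps (free_monoid \<Gamma>) i) (phi (free_monoid \<Gamma>) i)"
  and free_monoid_op_length:
    "w \<in> lists (cset \<Gamma>) \<Longrightarrow> eop (free_monoid \<Gamma>) i w = Some w' \<Longrightarrow> length w' = length w"
    "w \<in> lists (cset \<Gamma>) \<Longrightarrow> fop (free_monoid \<Gamma>) i w = Some w' \<Longrightarrow> length w' = length w"
proof -
  have data: "string_data {w \<in> lists (cset \<Gamma>). length w = n} (eop (tensor_power \<Gamma> n) i)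
    (fop (tensor_power \<Gamma> n) i) (eps (tensor_power \<Gamma> n) i) (phi (tensor_power \<Gamma> n) i)" for n
    using tensor_power_string_data[of n] by (simp add: cset_tensor_power)
  have mem: "w \<in> {v \<in> lists (cset \<Gamma>). length v = length w}" if "w \<in> lists (cset \<Gamma>)" for w
    using that by simp
  note d = string_dataD[OF data mem]
  have e: "y \<in> lists (cset \<Gamma>) \<and> length y = length w"
    if "w \<in> lists (cset \<Gamma>)" "eop (tensor_power \<Gamma> (length w)) i w = Some y" for w y
    using d(3)[OF that] by simp
  have f: "y \<in> lists (cset \<Gamma>) \<and> length y = length w"
    if "w \<in> lists (cset \<Gamma>)" "fop (tensor_power \<Gamma> (length w)) i w = Some y" for w y
    using d(9)[OF that] by simp
  show "w \<in> lists (cset \<Gamma>) \<Longrightarrow> eop (free_monoid \<Gamma>) i w = Some w' \<Longrightarrow> length w' = length w"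
    "w \<in> lists (cset \<Gamma>) \<Longrightarrow> fop (free_monoid \<Gamma>) i w = Some w' \<Longrightarrow> length w' = length w"
    using e[of w w'] f[of w w'] unfolding free_monoid_def by simp_all
  show "string_data (lists (cset \<Gamma>)) (eop (free_monoid \<Gamma>) i) (fop (free_monoid \<Gamma>) i)
    (eps (free_monoid \<Gamma>) i) (phi (free_monoid \<Gamma>) i)"
    unfolding string_data_def half_string_data_def
  proof (intro conjI ballI allI impI)
    fix w assume w: "w \<in> lists (cset \<Gamma>)"
    show "0 \<le> eps (free_monoid \<Gamma>) i w" "0 \<le> phi (free_monoid \<Gamma>) i w"
      "(eop (free_monoid \<Gamma>) i w = None) = (eps (free_monoid \<Gamma>) i w = 0)"
      "(fop (free_monoid \<Gamma>) i w = None) = (phi (free_monoid \<Gamma>) i w = 0)"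
      using d(1,2,7,8)[OF w] by (simp_all add: free_monoid_def)
    fix y
    show "y \<in> lists (cset \<Gamma>)" "fop (free_monoid \<Gamma>) i y = Some w"
      "eps (free_monoid \<Gamma>) i y = eps (free_monoid \<Gamma>) i w - 1"
      "phi (free_monoid \<Gamma>) i y = phi (free_monoid \<Gamma>) i w + 1"
      if "eop (free_monoid \<Gamma>) i w = Some y"
      using e[OF w, of y] d(4,5,6)[OF w, of y] that by (simp_all add: free_monoid_def)
    show "y \<in> lists (cset \<Gamma>)" "eop (free_monoid \<Gamma>) i y = Some w"
      "phi (free_monoid \<Gamma>) i y = phi (free_monoid \<Gamma>) i w - 1"
      "eps (free_monoid \<Gamma>) i y = eps (free_monoid \<Gamma>) i w + 1"
      if "fop (free_monoid \<Gamma>) i w = Some y"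
      using f[OF w, of y] d(10,11,12)[OF w, of y] that by (simp_all add: free_monoid_def)
  qed
qed

lemma free_monoid_Nil:
  "eop (free_monoid \<Gamma>) i [] = None" "fop (free_monoid \<Gamma>) i [] = None"
  "eps (free_monoid \<Gamma>) i [] = 0" "phi (free_monoid \<Gamma>) i [] = 0"
  by (simp_all add: free_monoid_def)

lemma free_monoid_Cons:
  "eop (free_monoid \<Gamma>) i (x # w) =
    (if eps (free_monoid \<Gamma>) i w \<le> phi \<Gamma> i x then map_option (\<lambda>x'. x' # w) (eop \<Gamma> i x)
     else map_option (Cons x) (eop (free_monoid \<Gamma>) i w))"
  "fop (free_monoid \<Gamma>) i (x # w) =
    (if eps (free_monoid \<Gamma>) i w < phi \<Gamma> i x then map_option (\<lambda>x'. x' # w) (fop \<Gamma> i x)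
     else map_option (Cons x) (fop (free_monoid \<Gamma>) i w))"
  by (simp_all add: free_monoid_def relabel_def tensor_def tensor_e_def tensor_f_def
      option.map_comp comp_def)

lemma free_monoid_eps_phi_Cons:
  assumes "x \<in> cset \<Gamma>" and "w \<in> lists (cset \<Gamma>)"
  shows "eps (free_monoid \<Gamma>) i (x # w)
      = eps \<Gamma> i x + max 0 (eps (free_monoid \<Gamma>) i w - phi \<Gamma> i x)"
    and "phi (free_monoid \<Gamma>) i (x # w)
      = phi (free_monoid \<Gamma>) i w + max 0 (phi \<Gamma> i x - eps (free_monoid \<Gamma>) i w)"
proof -
  have "w \<in> cset (tensor_power \<Gamma> (length w))" using assms by (simp add: cset_tensor_power)
  from tensor_power_Suc_string_data(2,3)[OF tensor_power_string_data assms(1) this]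
  show "eps (free_monoid \<Gamma>) i (x # w)
      = eps \<Gamma> i x + max 0 (eps (free_monoid \<Gamma>) i w - phi \<Gamma> i x)"
    "phi (free_monoid \<Gamma>) i (x # w)
      = phi (free_monoid \<Gamma>) i w + max 0 (phi \<Gamma> i x - eps (free_monoid \<Gamma>) i w)"
    by (simp_all add: free_monoid_def del: tensor_power.simps(2))
qed

text \<open>This is associativity of the cancellation count: removing matched pairs first between
  \<open>x\<close> and \<open>u\<close> or first between \<open>u\<close> and \<open>v\<close>
  leaves the same numbers. In the induction it becomes an identity between nested maxima.\<close>

lemma free_monoid_eps_phi_append:
  assumes "u \<in> lists (cset \<Gamma>)" and "v \<in> lists (cset \<Gamma>)"
  shows "eps (free_monoid \<Gamma>) i (u @ v) = eps (free_monoid \<Gamma>) i u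
      + max 0 (eps (free_monoid \<Gamma>) i v - phi (free_monoid \<Gamma>) i u) \<and>
    phi (free_monoid \<Gamma>) i (u @ v) = phi (free_monoid \<Gamma>) i v
      + max 0 (phi (free_monoid \<Gamma>) i u - eps (free_monoid \<Gamma>) i v)"
  using assms(1)
proof (induction u)
  case Nil
  have "0 \<le> eps (free_monoid \<Gamma>) i v"
    using string_dataD(1)[OF free_monoid_string_data assms(2)] .
  then show ?case by (simp add: free_monoid_Nil)
next
  case (Cons x u)
  then have "x \<in> cset \<Gamma>" "u \<in> lists (cset \<Gamma>)" "u @ v \<in> lists (cset \<Gamma>)" using assms(2) by auto
  then show ?case using Cons.IH by (simp add: free_monoid_eps_phi_Cons max_def)
qed

text \<open>When \<open>v\<close> wins against \<open>u\<close>, the test of \<open>u @ v\<close>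
  against the letter \<open>x\<close> is equivalent to the test of \<open>v\<close> against
  \<open>x # u\<close>, by the formulas for concatenations. When \<open>u\<close> wins,
  \<open>v\<close> also loses against \<open>x # u\<close>, whose \<open>phi\<close> is at least
  that of \<open>u\<close>.\<close>

lemma free_monoid_append:
  assumes "u \<in> lists (cset \<Gamma>)" and "v \<in> lists (cset \<Gamma>)"
  shows "eop (free_monoid \<Gamma>) i (u @ v) =
      (if eps (free_monoid \<Gamma>) i v \<le> phi (free_monoid \<Gamma>) i u
       then map_option (\<lambda>u'. u' @ v) (eop (free_monoid \<Gamma>) i u)
       else map_option ((@) u) (eop (free_monoid \<Gamma>) i v)) \<and>
    fop (free_monoid \<Gamma>) i (u @ v) =
      (if eps (free_monoid \<Gamma>) i v < phi (free_monoid \<Gamma>) i u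
       then map_option (\<lambda>u'. u' @ v) (fop (free_monoid \<Gamma>) i u)
       else map_option ((@) u) (fop (free_monoid \<Gamma>) i v))"
  using assms(1)
proof (induction u)
  case Nil
  \<comment> \<open>For \<open>eop\<close> the empty prefix is selected only when \<open>eps\<close>
    of \<open>v\<close> is 0, and then \<open>eop\<close> is undefined on \<open>v\<close> as well;
    \<open>fop\<close> never selects it.\<close>
  then show ?case
    using string_dataD(1,2)[OF free_monoid_string_data assms(2)]
    by (auto simp: free_monoid_Nil option.map_ident append_Nil[abs_def])
next
  case (Cons x u)
  then have xu: "x \<in> cset \<Gamma>" "u \<in> lists (cset \<Gamma>)" "u @ v \<in> lists (cset \<Gamma>)" using assms(2) by auto
  note d = string_dataD(1,7)[OF free_monoid_string_data]
  have "eps (free_monoid \<Gamma>) i (u @ v) = eps (free_monoid \<Gamma>) i u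
      + max 0 (eps (free_monoid \<Gamma>) i v - phi (free_monoid \<Gamma>) i u)"
    using free_monoid_eps_phi_append xu(2) assms(2) by blast
  then show ?case
    using Cons.IH xu string_dataD(1,2,7,8)[OF str xu(1)] d[OF xu(2)] d[OF assms(2)]
    by (auto simp: free_monoid_Cons free_monoid_eps_phi_Cons option.map_comp comp_def max_def
        append_Cons[abs_def] split: if_splits)
qed

end


section \<open>Kashiwara operators on words, steps and sequences\<close>

primrec kinv :: "'i kashiwara \<Rightarrow> 'i kashiwara" where
  "kinv (Raise i) = Lower i"
| "kinv (Lower i) = Raise i"

lemma kinv_kinv [simp]: "kinv (kinv k) = k"
  by (cases k) simp_all

lemma kinv_in_kashiwara_ops [simp]: "kinv k \<in> kashiwara_ops D \<longleftrightarrow> k \<in> kashiwara_ops D"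
  by (cases k) (auto simp: kashiwara_ops_def)

text \<open>There is no fixed point because the number that measures the remaining string drops by
  one.\<close>

lemma string_data_kact:
  assumes "\<And>i. i \<in> idx D \<Longrightarrow> string_data S (eop \<Gamma> i) (fop \<Gamma> i) (eps \<Gamma> i) (phi \<Gamma> i)"
    and "k \<in> kashiwara_ops D" and "x \<in> S" and "kact \<Gamma> k x = Some y"
  shows "y \<in> S" and "kact \<Gamma> (kinv k) y = Some x" and "y \<noteq> x"
proof -
  have "y \<in> S \<and> kact \<Gamma> (kinv k) y = Some x \<and> y \<noteq> x"
  proof (cases k)
    case (Raise i)
    then have "i \<in> idx D" "eop \<Gamma> i x = Some y" using assms(2,4) by (auto simp: kashiwara_ops_def)
    then show ?thesis using string_dataD(3-5)[OF assms(1) assms(3), of i y] Raise by auto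
  next
    case (Lower i)
    then have "i \<in> idx D" "fop \<Gamma> i x = Some y" using assms(2,4) by (auto simp: kashiwara_ops_def)
    then show ?thesis using string_dataD(9-11)[OF assms(1) assms(3), of i y] Lower by auto
  qed
  then show "y \<in> S" "kact \<Gamma> (kinv k) y = Some x" "y \<noteq> x" by blast+
qed

locale crystal_2polygraph =
  fixes D :: "('i, 'p::ab_group_add) cartan_datum"
    and X :: "('a, 'b) polygraph"
    and \<Gamma>\<^sub>1 :: "('a, 'i, 'p) crystal"
    and \<Gamma>\<^sub>2 :: "('b, 'i, 'p) crystal"
  assumes crystal: "crystal_polygraph D X \<Gamma>\<^sub>1 \<Gamma>\<^sub>2"
begin

text \<open>Membership in \<open>words\<close> is to be split at concatenations, not unfolded into a
  statement about all letters.\<close>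

declare in_lists_conv_set [simp del] in_listsD [rule del] in_listsI [rule del]

abbreviation "words \<equiv> lists (gens X)"
abbreviation "K \<equiv> kact (free_monoid \<Gamma>\<^sub>1)"
abbreviation "kstep \<equiv> kact_step X \<Gamma>\<^sub>1 \<Gamma>\<^sub>2"
abbreviation "krseq \<equiv> kact_rseq X \<Gamma>\<^sub>1 \<Gamma>\<^sub>2"
abbreviation "kbranching \<equiv> kact_branching X \<Gamma>\<^sub>1 \<Gamma>\<^sub>2"

definition same_strings :: "'a list \<Rightarrow> 'a list \<Rightarrow> bool" where
  "same_strings u v \<longleftrightarrow> (\<forall>i\<in>idx D. eps (free_monoid \<Gamma>\<^sub>1) i u = eps (free_monoid \<Gamma>\<^sub>1) i v \<and>
    phi (free_monoid \<Gamma>\<^sub>1) i u = phi (free_monoid \<Gamma>\<^sub>1) i v)"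

definition acts_left :: "'i kashiwara \<Rightarrow> 'a list \<Rightarrow> 'a list \<Rightarrow> bool" where
  "acts_left k u v \<longleftrightarrow> (case k of
      Raise i \<Rightarrow> eps (free_monoid \<Gamma>\<^sub>1) i v \<le> phi (free_monoid \<Gamma>\<^sub>1) i u
    | Lower i \<Rightarrow> eps (free_monoid \<Gamma>\<^sub>1) i v < phi (free_monoid \<Gamma>\<^sub>1) i u)"

lemma gens_eq: "cset \<Gamma>\<^sub>1 = gens X" and rules_eq: "cset \<Gamma>\<^sub>2 = rules X"
  using crystal unfolding crystal_polygraph_def by auto

lemma string_data_gens:
  "i \<in> idx D \<Longrightarrow> string_data (cset \<Gamma>\<^sub>1) (eop \<Gamma>\<^sub>1 i) (fop \<Gamma>\<^sub>1 i) (eps \<Gamma>\<^sub>1 i) (phi \<Gamma>\<^sub>1 i)"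
  and string_data_rules:
  "i \<in> idx D \<Longrightarrow> string_data (rules X) (eop \<Gamma>\<^sub>2 i) (fop \<Gamma>\<^sub>2 i) (eps \<Gamma>\<^sub>2 i) (phi \<Gamma>\<^sub>2 i)"
  using crystal normal_crystal_string_data rules_eq
  unfolding crystal_polygraph_def is_crystal_def by metis+

lemma string_data_words:
  "i \<in> idx D \<Longrightarrow> string_data words (eop (free_monoid \<Gamma>\<^sub>1) i) (fop (free_monoid \<Gamma>\<^sub>1) i)
    (eps (free_monoid \<Gamma>\<^sub>1) i) (phi (free_monoid \<Gamma>\<^sub>1) i)"
  using free_monoid_string_data[OF string_data_gens] by (simp add: gens_eq)

lemma
  assumes "k \<in> kashiwara_ops D" and "w \<in> words" and "K k w = Some w'"
  shows K_closed: "w' \<in> words" and K_inverse: "K (kinv k) w' = Some w" and K_neq: "w' \<noteq> w"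
  by (rule string_data_kact[OF _ assms], erule string_data_words)+

lemma
  assumes "k \<in> kashiwara_ops D" and "\<alpha> \<in> rules X" and "kact \<Gamma>\<^sub>2 k \<alpha> = Some \<alpha>'"
  shows krule_closed: "\<alpha>' \<in> rules X" and krule_inverse: "kact \<Gamma>\<^sub>2 (kinv k) \<alpha>' = Some \<alpha>"
  by (rule string_data_kact[OF _ assms], erule string_data_rules)+

lemma K_length:
  "k \<in> kashiwara_ops D \<Longrightarrow> w \<in> words \<Longrightarrow> K k w = Some w' \<Longrightarrow> length w' = length w"
  using free_monoid_op_length[OF string_data_gens]
  by (cases k) (auto simp: kashiwara_ops_def gens_eq)

lemma K_append:
  assumes "k \<in> kashiwara_ops D" "u \<in> words" "v \<in> words"
  shows "K k (u @ v) = (if acts_left k u v then map_option (\<lambda>u'. u' @ v) (K k u)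
    else map_option ((@) u) (K k v))"
  using free_monoid_append[OF string_data_gens] assms
  by (cases k) (auto simp: kashiwara_ops_def gens_eq acts_left_def)

lemma acts_left_cong:
  assumes "k \<in> kashiwara_ops D" "same_strings u u'" "same_strings v v'"
  shows "acts_left k u v = acts_left k u' v'"
  using assms by (cases k) (auto simp: kashiwara_ops_def same_strings_def acts_left_def)

lemma same_strings_refl [simp]: "same_strings u u"
  by (simp add: same_strings_def)

lemma same_strings_append:
  assumes "same_strings u u'" "same_strings v v'"
    and "u \<in> words" "u' \<in> words" "v \<in> words" "v' \<in> words"
  shows "same_strings (u @ v) (u' @ v')"
  using assms free_monoid_eps_phi_append[OF string_data_gens]
  by (simp add: same_strings_def gens_eq)

lemma rule_words:
  assumes "\<alpha> \<in> rules X"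
  shows "src X \<alpha> \<in> words" and "tgt X \<alpha> \<in> words"
  using assms crystal unfolding crystal_polygraph_def polygraph2_def by auto

lemma K_src_tgt:
  assumes "\<alpha> \<in> rules X" "k \<in> kashiwara_ops D"
  shows "K k (src X \<alpha>) = map_option (src X) (kact \<Gamma>\<^sub>2 k \<alpha>)"
    and "K k (tgt X \<alpha>) = map_option (tgt X) (kact \<Gamma>\<^sub>2 k \<alpha>)"
  using assms crystal rules_eq unfolding crystal_polygraph_def crystal_morphism_def
  by (cases k; force simp: kashiwara_ops_def)+

lemma same_strings_src_tgt: "\<alpha> \<in> rules X \<Longrightarrow> same_strings (src X \<alpha>) (tgt X \<alpha>)"
  using crystal rules_eq unfolding crystal_polygraph_def crystal_morphism_def same_strings_def
  by simp

text \<open>The last clause of each case is stated for every \<open>r\<close> with the strings of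
  \<open>s\<close>: the case is found on the source of a rule and then applied to its target. In the
  middle case \<open>r\<close> has its own image \<open>r'\<close>.\<close>

lemma K_append3_cases:
  assumes k: "k \<in> kashiwara_ops D" and tsv: "t \<in> words" "s \<in> words" "v \<in> words"
    and K: "K k (t @ s @ v) = Some w"
  obtains (left) t' where "K k t = Some t'" "w = t' @ s @ v"
      "\<And>r. r \<in> words \<Longrightarrow> same_strings s r \<Longrightarrow> K k (t @ r @ v) = Some (t' @ r @ v)"
  | (middle) s' where "K k s = Some s'" "w = t @ s' @ v"
      "\<And>r r'. r \<in> words \<Longrightarrow> same_strings s r \<Longrightarrow> K k r = Some r' \<Longrightarrow>
        K k (t @ r @ v) = Some (t @ r' @ v)"
  | (right) v' where "K k v = Some v'" "w = t @ s @ v'"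
      "\<And>r. r \<in> words \<Longrightarrow> same_strings s r \<Longrightarrow> K k (t @ r @ v) = Some (t @ r @ v')"
proof -
  \<comment> \<open>Both tests are made with \<open>s\<close> although the word contains
    \<open>r\<close>, so a single case distinction serves all \<open>r\<close> at once.\<close>
  have app: "K k (t @ r @ v) = (if acts_left k t (s @ v) then map_option (\<lambda>t'. t' @ r @ v) (K k t)
      else if acts_left k s v then map_option (\<lambda>r'. t @ r' @ v) (K k r)
      else map_option (\<lambda>v'. t @ r @ v') (K k v))" if r: "r \<in> words" "same_strings s r" for r
  proof -
    have "acts_left k t (s @ v) = acts_left k t (r @ v)" "acts_left k s v = acts_left k r v"
      using acts_left_cong[OF k] r(2) same_strings_append[OF r(2) same_strings_refl tsv(2) r(1) tsv(3) tsv(3)]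
      by simp_all
    then show ?thesis
      using k r tsv by (simp add: K_append option.map_comp comp_def)
  qed
  show thesis
  proof (cases "acts_left k t (s @ v)")
    case True
    then obtain t' where "K k t = Some t'" "w = t' @ s @ v"
      using K app[OF tsv(2)] by auto
    then show thesis using left app True by simp
  next
    case nl: False
    show thesis
    proof (cases "acts_left k s v")
      case True
      then obtain s' where "K k s = Some s'" "w = t @ s' @ v"
        using K app[OF tsv(2)] nl by auto
      then show thesis using middle app True nl by simp
    next
      case False
      then obtain v' where "K k v = Some v'" "w = t @ s @ v'"
        using K app[OF tsv(2)] nl by auto
      then show thesis using right app False nl by simp
    qed
  qed
qed

section \<open>Action on single rewriting steps\<close>

lemma kstep_left:
  assumes "K k t = Some t'" "K k (t @ src X \<alpha> @ v) = Some (t' @ src X \<alpha> @ v)"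
  shows "kstep k (t, \<alpha>, v) = Some (t', \<alpha>, v)"
  using assms by (simp add: kact_step_def Let_def)

text \<open>The left block is tried first and must be excluded. If it matched, equal lengths of
  \<open>t\<close> and its image would force the source of the rule to be fixed.\<close>

lemma kstep_middle:
  assumes "k \<in> kashiwara_ops D" "t \<in> words" "\<alpha> \<in> rules X"
    and "kact \<Gamma>\<^sub>2 k \<alpha> = Some \<alpha>'" "K k (t @ src X \<alpha> @ v) = Some (t @ src X \<alpha>' @ v)"
  shows "kstep k (t, \<alpha>, v) = Some (t, \<alpha>', v)"
proof -
  have s: "K k (src X \<alpha>) = Some (src X \<alpha>')" using assms K_src_tgt by simp
  then have "src X \<alpha>' \<noteq> src X \<alpha>" using K_neq assms rule_words by blast
  then show ?thesis
    using assms s K_length[OF assms(1,2)]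
    by (cases "K k t") (auto simp: kact_step_def Let_def)
qed

text \<open>A match on either earlier block would, by equality of lengths, give
  \<open>v' = v\<close>.\<close>

lemma kstep_right:
  assumes "k \<in> kashiwara_ops D" "t \<in> words" "\<alpha> \<in> rules X" "v \<in> words"
    and "K k v = Some v'" "K k (t @ src X \<alpha> @ v) = Some (t @ src X \<alpha> @ v')"
  shows "kstep k (t, \<alpha>, v) = Some (t, \<alpha>, v')"
proof -
  have "v' \<noteq> v" using K_neq assms by blast
  moreover have "s' @ v \<noteq> src X \<alpha> @ v'" if "K k (src X \<alpha>) = Some s'" for s'
    using that K_length[OF assms(1) rule_words(1)[OF assms(3)]] \<open>v' \<noteq> v\<close> by auto
  moreover have "t' @ src X \<alpha> @ v \<noteq> t @ src X \<alpha> @ v'" if "K k t = Some t'" for t'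
    using that K_length[OF assms(1,2)] \<open>v' \<noteq> v\<close> by auto
  ultimately show ?thesis
    using assms
    by (cases "K k t"; cases "K k (src X \<alpha>)") (auto simp: kact_step_def Let_def)
qed

lemma stepsD:
  "(t, \<alpha>, v) \<in> steps X \<Longrightarrow> t \<in> words" "(t, \<alpha>, v) \<in> steps X \<Longrightarrow> \<alpha> \<in> rules X"
  "(t, \<alpha>, v) \<in> steps X \<Longrightarrow> v \<in> words"
  by (auto simp: steps_def)

lemma step_words: "f \<in> steps X \<Longrightarrow> step_src X f \<in> words" "f \<in> steps X \<Longrightarrow> step_tgt X f \<in> words"
  using rule_words by (auto simp: steps_def step_src_def step_tgt_def)

lemma whisker_steps: "f \<in> steps X \<Longrightarrow> u \<in> words \<Longrightarrow> v \<in> words \<Longrightarrow> whisker u f v \<in> steps X"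
  by (auto simp: whisker_def steps_def)

lemma step_src_whisker: "step_src X (whisker u f v) = u @ step_src X f @ v"
  by (simp add: whisker_def step_src_def split: prod.splits)

text \<open>The clause on targets lets consecutive steps be chained; the last clause, the source of
  all converses, holds because the opposite operator undoes the change in the same block.\<close>

lemma kstep_exists:
  assumes k: "k \<in> kashiwara_ops D" and f: "f \<in> steps X" and K: "K k (step_src X f) = Some w"
  obtains f' where "kstep k f = Some f'" "f' \<in> steps X" "step_src X f' = w"
    "K k (step_tgt X f) = Some (step_tgt X f')" "kstep (kinv k) f' = Some f"
proof -
  obtain t \<alpha> v where tav: "f = (t, \<alpha>, v)" by (cases f)
  note m = stepsD[OF f[unfolded tav]]
  note s = rule_words[OF m(2)] same_strings_src_tgt[OF m(2)]
  have k': "kinv k \<in> kashiwara_ops D" using k by simp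
  have Kw: "K k (t @ src X \<alpha> @ v) = Some w" using K by (simp add: tav step_src_def)
  have inv: "K (kinv k) w = Some (t @ src X \<alpha> @ v)"
    using K_inverse[OF k _ K] step_words(1)[OF f] by (simp add: tav step_src_def)
  from k m(1) s(1) m(3) Kw show thesis
  proof (cases rule: K_append3_cases)
    case (left t')
    show thesis
    proof (rule that)
      show "kstep k f = Some (t', \<alpha>, v)" using kstep_left left Kw tav by simp
      show "(t', \<alpha>, v) \<in> steps X" using K_closed[OF k m(1)] left m by (simp add: steps_def)
      show "step_src X (t', \<alpha>, v) = w" using left by (simp add: step_src_def)
      show "K k (step_tgt X f) = Some (step_tgt X (t', \<alpha>, v))"
        using left(3)[OF s(2,3)] by (simp add: step_tgt_def tav)
      show "kstep (kinv k) (t', \<alpha>, v) = Some f"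
        using kstep_left K_inverse[OF k m(1)] left inv tav by simp
    qed
  next
    case (middle s')
    obtain \<alpha>' where a: "kact \<Gamma>\<^sub>2 k \<alpha> = Some \<alpha>'" "s' = src X \<alpha>'"
      using middle(1) K_src_tgt(1)[OF m(2) k] by auto
    have a': "\<alpha>' \<in> rules X" using krule_closed[OF k m(2) a(1)] by simp
    have ai: "kact \<Gamma>\<^sub>2 (kinv k) \<alpha>' = Some \<alpha>" using krule_inverse[OF k m(2) a(1)] by simp
    show thesis
    proof (rule that)
      show "kstep k f = Some (t, \<alpha>', v)" using kstep_middle[OF k m(1,2) a(1)] middle a Kw tav by simp
      show "(t, \<alpha>', v) \<in> steps X" using a' m by (simp add: steps_def)
      show "step_src X (t, \<alpha>', v) = w" using middle a by (simp add: step_src_def)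
      show "K k (step_tgt X f) = Some (step_tgt X (t, \<alpha>', v))"
        using middle(3)[OF s(2,3)] K_src_tgt(2)[OF m(2) k] a by (simp add: step_tgt_def tav)
      show "kstep (kinv k) (t, \<alpha>', v) = Some f"
        using kstep_middle[OF k' m(1) a' ai] middle a inv tav by simp
    qed
  next
    case (right v')
    have v': "v' \<in> words" "K (kinv k) v' = Some v"
      using K_closed[OF k m(3)] K_inverse[OF k m(3)] right(1) by simp_all
    show thesis
    proof (rule that)
      show "kstep k f = Some (t, \<alpha>, v')" using kstep_right[OF k m] right Kw tav by simp
      show "(t, \<alpha>, v') \<in> steps X" using v' m by (simp add: steps_def)
      show "step_src X (t, \<alpha>, v') = w" using right by (simp add: step_src_def)
      show "K k (step_tgt X f) = Some (step_tgt X (t, \<alpha>, v'))"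
        using right(3)[OF s(2,3)] by (simp add: step_tgt_def tav)
      show "kstep (kinv k) (t, \<alpha>, v') = Some f"
        using kstep_right[OF k' m(1,2) v'] right inv tav by simp
    qed
  qed
qed

section \<open>Action on rewriting sequences and their ends\<close>

lemma composable_kstep:
  assumes k: "k \<in> kashiwara_ops D" and "composable X w fs" and "w \<in> words" and "K k w = Some w'"
  shows "\<exists>fs'. those (map (kstep k) fs) = Some fs' \<and> composable X w' fs' \<and>
    those (map (kstep (kinv k)) fs') = Some fs \<and>
    K k (rseq_tgt X (w, fs)) = Some (rseq_tgt X (w', fs'))"
  using assms(2-4)
proof (induction fs arbitrary: w w')
  case Nil
  then show ?case by (simp add: rseq_tgt_def)
next
  case (Cons f fs)
  then have f: "f \<in> steps X" "step_src X f = w" by auto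
  obtain f' where f': "kstep k f = Some f'" "f' \<in> steps X" "step_src X f' = w'"
    "K k (step_tgt X f) = Some (step_tgt X f')" "kstep (kinv k) f' = Some f"
    using kstep_exists[OF k f(1)] f(2) Cons.prems(3) by metis
  have "composable X (step_tgt X f) fs" using Cons.prems by simp
  from Cons.IH[OF this step_words(2)[OF f(1)] f'(4)] obtain fs' where fs':
    "those (map (kstep k) fs) = Some fs'" "composable X (step_tgt X f') fs'"
    "those (map (kstep (kinv k)) fs') = Some fs"
    "K k (rseq_tgt X (step_tgt X f, fs)) = Some (rseq_tgt X (step_tgt X f', fs'))"
    by blast
  have "rseq_tgt X (w, f # fs) = rseq_tgt X (step_tgt X f, fs)"
    "rseq_tgt X (w', f' # fs') = rseq_tgt X (step_tgt X f', fs')"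
    by (simp_all add: rseq_tgt_def)
  then show ?case using f' fs' by (intro exI[of _ "f' # fs'"]) simp
qed

text \<open>Only the first word is assumed to survive: each step hands a defined image of its source
  on to its target, so the whole sequence survives.\<close>

lemma krseq_exists:
  assumes k: "k \<in> kashiwara_ops D" and p: "p \<in> rseqs X" and K: "K k (rseq_src p) = Some w"
  obtains p' where "krseq k p = Some p'" "p' \<in> rseqs X" "rseq_src p' = w"
    "K k (rseq_tgt X p) = Some (rseq_tgt X p')" "krseq (kinv k) p' = Some p"
proof -
  obtain u fs where u: "p = (u, fs)" by (cases p)
  have uw: "composable X u fs" "u \<in> words" "K k u = Some w"
    using p K u by (auto simp: rseqs_def rseq_src_def)
  from composable_kstep[OF k this] obtain fs' where fs':
    "those (map (kstep k) fs) = Some fs'" "composable X w fs'"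
    "those (map (kstep (kinv k)) fs') = Some fs"
    "K k (rseq_tgt X (u, fs)) = Some (rseq_tgt X (w, fs'))" by blast
  have w: "w \<in> words" "K (kinv k) w = Some u"
    using K_closed[OF k uw(2,3)] K_inverse[OF k uw(2,3)] by simp_all
  show thesis
    by (rule that[of "(w, fs')"])
      (use fs' w uw in \<open>simp_all add: u kact_rseq_def rseqs_def rseq_src_def\<close>)
qed

lemma rseq_src_single_step [simp]: "rseq_src (single_step X f) = step_src X f"
  by (simp add: single_step_def rseq_src_def)

lemma single_step_inject [simp]: "single_step X f = single_step X g \<longleftrightarrow> f = g"
  by (auto simp: single_step_def)

lemma krseq_single_step:
  assumes k: "k \<in> kashiwara_ops D" and f: "f \<in> steps X" and K: "K k (step_src X f) = Some w"
    and "kstep k f = Some f'"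
  shows "krseq k (single_step X f) = Some (single_step X f')"
proof (rule kstep_exists[OF k f K])
  fix f'' assume "kstep k f = Some f''" "step_src X f'' = w"
  then show ?thesis using assms(4) K by (simp add: kact_rseq_def single_step_def)
qed

section \<open>Steps in a context\<close>

lemma kstep_whisker_left:
  assumes "K k u = Some u'"
    and "K k (u @ step_src X f @ v) = Some (u' @ step_src X f @ v)"
    and k: "k \<in> kashiwara_ops D" and f: "f \<in> steps X" and uv: "u \<in> words" "v \<in> words"
  shows "kstep k (whisker u f v) = Some (whisker u' f v)"
proof -
  obtain t \<alpha> r where tar: "f = (t, \<alpha>, r)" by (cases f)
  note m = stepsD[OF f[unfolded tar]]
  note neq = K_neq[OF k uv(1) assms(1)] K_length[OF k uv(1) assms(1)]
  have w: "K k ((u @ t) @ src X \<alpha> @ (r @ v)) = Some (u' @ t @ src X \<alpha> @ r @ v)"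
    using assms(2) by (simp add: tar step_src_def)
  have "u @ t \<in> words" "r @ v \<in> words" using m uv by simp_all
  \<comment> \<open>The word is regrouped around the rule. If the rule or the right block changed,
    the prefix \<open>u @ t\<close> would stay, and equal lengths would give
    \<open>u' = u\<close>.\<close>
  from k this(1) rule_words(1)[OF m(2)] this(2) w have "K k (u @ t) = Some (u' @ t)"
    by (cases rule: K_append3_cases) (use neq K_length[OF k] \<open>u @ t \<in> words\<close> in auto)
  then show ?thesis using kstep_left w by (simp add: tar whisker_def)
qed

lemma kstep_whisker_right:
  assumes "K k v = Some v'"
    and "K k (u @ step_src X f @ v) = Some (u @ step_src X f @ v')"
    and k: "k \<in> kashiwara_ops D" and f: "f \<in> steps X" and uv: "u \<in> words" "v \<in> words"
  shows "kstep k (whisker u f v) = Some (whisker u f v')"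
proof -
  obtain t \<alpha> r where tar: "f = (t, \<alpha>, r)" by (cases f)
  note m = stepsD[OF f[unfolded tar]]
  note neq = K_neq[OF k uv(2) assms(1)] K_length[OF k uv(2) assms(1)]
  have w: "K k ((u @ t) @ src X \<alpha> @ (r @ v)) = Some ((u @ t) @ src X \<alpha> @ (r @ v'))"
    using assms(2) by (simp add: tar step_src_def)
  have ut: "u @ t \<in> words" and rv: "r @ v \<in> words" using m uv by simp_all
  \<comment> \<open>A change in the left block or in the rule would leave the suffix
    \<open>r @ v\<close>, forcing \<open>v' = v\<close>.\<close>
  from k ut rule_words(1)[OF m(2)] rv w have "K k (r @ v) = Some (r @ v')"
  proof (cases rule: K_append3_cases)
    case (left t')
    then show ?thesis
      using neq K_length[OF k ut left(1)]
        append_eq_append_conv[of "u @ t" t' "src X \<alpha> @ r @ v'" "src X \<alpha> @ r @ v"] by simp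
  next
    case (middle s')
    then show ?thesis using neq K_length[OF k rule_words(1)[OF m(2)] middle(1)] by auto
  qed auto
  then show ?thesis using kstep_right[OF k ut m(2) rv] w by (simp add: tar whisker_def)
qed

text \<open>The action on \<open>f\<close> alone and the action on the whiskered step choose a block
  independently. The image \<open>w\<close> of the source of \<open>f\<close> is common to both, and
  comparing it with that source shows that they choose the same block with the same image.\<close>

lemma kstep_whisker_middle:
  assumes f': "kstep k f = Some f'"
    and K: "K k (u @ step_src X f @ v) = Some (u @ w @ v)" "K k (step_src X f) = Some w"
    and k: "k \<in> kashiwara_ops D" and f: "f \<in> steps X" and uv: "u \<in> words" "v \<in> words"
  shows "kstep k (whisker u f v) = Some (whisker u f' v)"
proof -
  obtain t \<alpha> r where tar: "f = (t, \<alpha>, r)" by (cases f)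
  note m = stepsD[OF f[unfolded tar]]
  note s = rule_words(1)[OF m(2)]
  have ut: "u @ t \<in> words" and rv: "r @ v \<in> words" using m uv by simp_all
  have w0: "K k (t @ src X \<alpha> @ r) = Some w" using K by (simp add: tar step_src_def)
  have w1: "K k ((u @ t) @ src X \<alpha> @ (r @ v)) = Some (u @ w @ v)"
    using K by (simp add: tar step_src_def)
  from k m(1) s m(3) w0 show ?thesis
  proof (cases rule: K_append3_cases)
    case (left t')
    note neq = K_neq[OF k m(1) left(1)] K_length[OF k m(1) left(1)]
    from k ut s rv w1 have "K k (u @ t) = Some (u @ t')"
      by (cases rule: K_append3_cases) (use left(2) neq K_length[OF k ut] in auto)
    then show ?thesis
      using kstep_left[of k t t' \<alpha> r] kstep_left[of k "u @ t" "u @ t'" \<alpha> "r @ v"] left w0 w1 f'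
      by (auto simp: tar whisker_def)
  next
    case (middle s')
    obtain \<alpha>' where a: "kact \<Gamma>\<^sub>2 k \<alpha> = Some \<alpha>'" "s' = src X \<alpha>'"
      using middle(1) K_src_tgt(1)[OF m(2) k] by auto
    show ?thesis
      using kstep_middle[OF k m(1,2) a(1)] kstep_middle[OF k ut m(2) a(1)] middle a w0 w1 f'
      by (auto simp: tar whisker_def)
  next
    case (right r')
    note neq = K_neq[OF k m(3) right(1)] K_length[OF k m(3) right(1)]
    from k ut s rv w1 have "K k (r @ v) = Some (r' @ v)"
    proof (cases rule: K_append3_cases)
      case (left t')
      then show ?thesis
        using right(2) neq K_length[OF k ut left(1)]
          append_eq_append_conv[of "u @ t" t' "src X \<alpha> @ r' @ v" "src X \<alpha> @ r @ v"] by simp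
    next
      case (middle s')
      then show ?thesis using right(2) neq K_length[OF k s middle(1)] by auto
    qed (use right(2) in auto)
    then show ?thesis
      using kstep_right[OF k m right(1)] kstep_right[OF k ut m(2) rv, of "r' @ v"] right(2) w0 w1 f'
      by (auto simp: tar whisker_def)
  qed
qed

section \<open>Branchings\<close>

lemma kbranching_SomeD:
  assumes k: "k \<in> kashiwara_ops D" and b: "b \<in> Br X" and "kbranching k b = Some b'"
  obtains p q p' q' where "b = (p, q)" "b' = (p', q')" "p' \<in> rseqs X" "q' \<in> rseqs X"
    "K k (rseq_src p) = Some (rseq_src p')" "rseq_src p' = rseq_src q'"
    "krseq k p = Some p'" "krseq k q = Some q'"
    "krseq (kinv k) p' = Some p" "krseq (kinv k) q' = Some q"
    "K k (rseq_tgt X p) = Some (rseq_tgt X p')" "K k (rseq_tgt X q) = Some (rseq_tgt X q')"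
proof -
  obtain p q where pq: "b = (p, q)" by (cases b)
  have m: "p \<in> rseqs X" "q \<in> rseqs X" "rseq_src p = rseq_src q" using b pq by (auto simp: Br_def)
  obtain w where w: "K k (rseq_src p) = Some w"
    using assms(3) pq by (auto simp: kact_branching_def split: if_splits)
  obtain p' where p': "krseq k p = Some p'" "p' \<in> rseqs X" "rseq_src p' = w"
    "K k (rseq_tgt X p) = Some (rseq_tgt X p')" "krseq (kinv k) p' = Some p"
    using krseq_exists[OF k m(1) w] by metis
  obtain q' where q': "krseq k q = Some q'" "q' \<in> rseqs X" "rseq_src q' = w"
    "K k (rseq_tgt X q) = Some (rseq_tgt X q')" "krseq (kinv k) q' = Some q"
    using krseq_exists[OF k m(2)] w m(3) by metis
  have "b' = (p', q')" using assms(3) pq p' q' w by (simp add: kact_branching_def)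
  then show thesis using that pq p' q' w by simp
qed

lemma rseq_src_words: "p \<in> rseqs X \<Longrightarrow> rseq_src p \<in> words"
  by (auto simp: rseqs_def rseq_src_def)

lemma kbranching_inverse:
  assumes k: "k \<in> kashiwara_ops D" and b: "b \<in> Br X" and "kbranching k b = Some b'"
  shows "b' \<in> Br X" and "kbranching (kinv k) b' = Some b"
proof -
  obtain p q p' q' where s: "b = (p, q)" "b' = (p', q')" "p' \<in> rseqs X" "q' \<in> rseqs X"
    "K k (rseq_src p) = Some (rseq_src p')" "rseq_src p' = rseq_src q'"
    "krseq (kinv k) p' = Some p" "krseq (kinv k) q' = Some q"
    by (rule kbranching_SomeD[OF assms]) (rule that; assumption)
  then show "b' \<in> Br X" by (simp add: Br_def)
  have "rseq_src p \<in> words" using b s rseq_src_words by (auto simp: Br_def)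
  then have "K (kinv k) (rseq_src p') = Some (rseq_src p)" using K_inverse[OF k] s(5) by blast
  then show "kbranching (kinv k) b' = Some b" using s by (simp add: kact_branching_def)
qed

text \<open>The premise quantifies over operators and branchings so that it can also be used for
  \<open>kinv k\<close> at \<open>b'\<close>, which leads back to \<open>b\<close>.\<close>

lemma kbranching_invariant:
  assumes "\<And>k b b'. k \<in> kashiwara_ops D \<Longrightarrow> b \<in> Br X \<Longrightarrow> kbranching k b = Some b' \<Longrightarrow>
      b \<in> S \<Longrightarrow> b' \<in> S"
    and "k \<in> kashiwara_ops D" "b \<in> Br X" "kbranching k b = Some b'"
  shows "b \<in> S \<longleftrightarrow> b' \<in> S"
  using assms kbranching_inverse[OF assms(2-4)] kinv_in_kashiwara_ops by blast

lemma kbranching_single_step: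
  assumes k: "k \<in> kashiwara_ops D" and "f \<in> steps X" "g \<in> steps X" "step_src X f = step_src X g"
    and b': "kbranching k (single_step X f, single_step X g) = Some b'"
  obtains f' g' where "b' = (single_step X f', single_step X g')" "f' \<in> steps X" "g' \<in> steps X"
    "K k (step_src X f) = Some (step_src X f')" "step_src X f' = step_src X g'"
    "kstep k f = Some f'" "kstep k g = Some g'"
proof -
  obtain w where w: "K k (step_src X f) = Some w"
    using b' by (auto simp: kact_branching_def split: if_splits)
  obtain f' where f': "kstep k f = Some f'" "f' \<in> steps X" "step_src X f' = w"
    using kstep_exists[OF k assms(2) w] by metis
  obtain g' where g': "kstep k g = Some g'" "g' \<in> steps X" "step_src X g' = w"
    using kstep_exists[OF k assms(3)] w assms(4) by metis
  have "b' = (single_step X f', single_step X g')"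
    using b' w assms(4) krseq_single_step[OF k assms(2) w f'(1)]
      krseq_single_step[OF k assms(3) _ g'(1)] by (simp add: kact_branching_def)
  then show thesis using that f' g' w by simp
qed

lemma LBrE:
  assumes "b \<in> LBr X"
  obtains f g where "b = (single_step X f, single_step X g)" "f \<in> steps X" "g \<in> steps X"
    "step_src X f = step_src X g"
  using assms by (auto simp: LBr_def)

lemma LBrI:
  "f \<in> steps X \<Longrightarrow> g \<in> steps X \<Longrightarrow> step_src X f = step_src X g \<Longrightarrow>
    (single_step X f, single_step X g) \<in> LBr X"
  unfolding LBr_def by blast

section \<open>Properties carried forward by one operator\<close>

context
  fixes k b b'
  assumes k: "k \<in> kashiwara_ops D" and b: "b \<in> Br X" and b': "kbranching k b = Some b'"
begin

lemma LBr_invariant_forward: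
  assumes "b \<in> LBr X"
  shows "b' \<in> LBr X"
proof -
  obtain f g where fg: "b = (single_step X f, single_step X g)" "f \<in> steps X" "g \<in> steps X"
    "step_src X f = step_src X g"
    using assms by (rule LBrE)
  have "kbranching k (single_step X f, single_step X g) = Some b'" using b' fg(1) by simp
  then show ?thesis
  proof (rule kbranching_single_step[OF k fg(2-4)])
    fix f' g' assume "b' = (single_step X f', single_step X g')" "f' \<in> steps X" "g' \<in> steps X"
      "step_src X f' = step_src X g'"
    then show ?thesis by (simp only: LBrI)
  qed
qed

text \<open>The two closing sequences start at the targets of the branching, which the operator
  sends to the targets of the image. Their images end in one word because the originals do.\<close>

lemma Confl_invariant_forward:
  assumes "b \<in> Confl X"
  shows "b' \<in> Confl X"
proof -
  obtain p q p' q' where s: "b = (p, q)" "b' = (p', q')"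
    "K k (rseq_tgt X p) = Some (rseq_tgt X p')" "K k (rseq_tgt X q) = Some (rseq_tgt X q')"
    by (rule kbranching_SomeD[OF k b b']) (rule that; assumption)
  obtain r r' where r: "r \<in> rseqs X" "r' \<in> rseqs X" "rseq_src r = rseq_tgt X p"
    "rseq_src r' = rseq_tgt X q" "rseq_tgt X r = rseq_tgt X r'"
    using assms s(1) by (auto simp: Confl_def)
  obtain s1 where s1: "s1 \<in> rseqs X" "rseq_src s1 = rseq_tgt X p'"
    "K k (rseq_tgt X r) = Some (rseq_tgt X s1)"
    using krseq_exists[OF k r(1)] r(3) s(3) by metis
  obtain s2 where s2: "s2 \<in> rseqs X" "rseq_src s2 = rseq_tgt X q'"
    "K k (rseq_tgt X r') = Some (rseq_tgt X s2)"
    using krseq_exists[OF k r(2)] r(4) s(4) by metis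
  have "(p', q') \<in> Br X" using kbranching_inverse(1)[OF k b b'] s(2) by simp
  moreover have "rseq_tgt X s1 = rseq_tgt X s2" using s1(3) s2(3) r(5) by simp
  then have "\<exists>r\<in>rseqs X. \<exists>r'\<in>rseqs X. rseq_src r = rseq_tgt X p' \<and> rseq_src r' = rseq_tgt X q' \<and>
      rseq_tgt X r = rseq_tgt X r'"
    using s1(1,2) s2(1,2) by (intro bexI[of _ s1] bexI[of _ s2] conjI)
  ultimately show ?thesis using s(2) by (simp add: Confl_def)
qed

lemma Aspherical_invariant_forward:
  assumes "b \<in> Aspherical X"
  shows "b' \<in> Aspherical X"
proof -
  obtain f where f: "b = (single_step X f, single_step X f)" "f \<in> steps X"
    using assms by (auto simp: Aspherical_def)
  have "kbranching k (single_step X f, single_step X f) = Some b'" using b' f(1) by simp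
  then show ?thesis
  proof (rule kbranching_single_step[OF k f(2) f(2) refl])
    fix f' g' assume "b' = (single_step X f', single_step X g')" "f' \<in> steps X"
      "kstep k f = Some f'" "kstep k f = Some g'"
    then show ?thesis
      unfolding Aspherical_def by (intro CollectI exI[of _ f']) simp
  qed
qed

lemma Peiffer_invariant_forward:
  assumes "b \<in> Peiffer X"
  shows "b' \<in> Peiffer X"
proof -
  obtain f g where fg: "f \<in> steps X" "g \<in> steps X" and bfg:
    "b = (single_step X (whisker [] f (step_src X g)), single_step X (whisker (step_src X f) g []))
    \<or> b = (single_step X (whisker (step_src X f) g []), single_step X (whisker [] f (step_src X g)))"
    using assms by (auto simp: Peiffer_def Let_def)
  let ?u = "step_src X f" and ?v = "step_src X g"
  have uv: "?u \<in> words" "?v \<in> words" using step_words fg by auto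
  have src: "step_src X (whisker [] f ?v) = ?u @ ?v" "step_src X (whisker ?u g []) = ?u @ ?v"
    by (simp_all add: step_src_whisker)
  have st: "whisker [] f ?v \<in> steps X" "whisker ?u g [] \<in> steps X"
    using whisker_steps fg uv by auto
  \<comment> \<open>The left context of \<open>g\<close> is the source of \<open>f\<close>, and the
    right context of \<open>f\<close> is the source of \<open>g\<close>. If the operator moves the
    source of \<open>f\<close>, it turns \<open>f\<close> into \<open>f'\<close> in one step and the
    context of \<open>g\<close> into the source of \<open>f'\<close> in the other, so the disjoint
    shape persists; likewise for \<open>g\<close>.\<close>
  have "\<exists>f'\<in>steps X. \<exists>g'\<in>steps X. kstep k (whisker [] f ?v) = Some (whisker [] f' (step_src X g'))
      \<and> kstep k (whisker ?u g []) = Some (whisker (step_src X f') g' [])"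
    if w: "K k (?u @ ?v) = Some w" for w
  proof (cases "acts_left k ?u ?v")
    case True
    then obtain u' where u': "K k ?u = Some u'" "w = u' @ ?v"
      using w K_append[OF k uv] by auto
    obtain f' where f': "kstep k f = Some f'" "f' \<in> steps X" "step_src X f' = u'"
      using kstep_exists[OF k fg(1) u'(1)] by metis
    have "kstep k (whisker [] f ?v) = Some (whisker [] f' ?v)"
      using kstep_whisker_middle[OF f'(1) _ u'(1) k fg(1) _ uv(2), of "[]"] w u' by simp
    moreover have "kstep k (whisker ?u g []) = Some (whisker u' g [])"
      using kstep_whisker_left[OF u'(1) _ k fg(2) uv(1), of "[]"] w u' by simp
    ultimately show ?thesis using f' fg by auto
  next
    case False
    then obtain v' where v': "K k ?v = Some v'" "w = ?u @ v'"
      using w K_append[OF k uv] by auto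
    obtain g' where g': "kstep k g = Some g'" "g' \<in> steps X" "step_src X g' = v'"
      using kstep_exists[OF k fg(2) v'(1)] by metis
    have "kstep k (whisker ?u g []) = Some (whisker ?u g' [])"
      using kstep_whisker_middle[OF g'(1) _ v'(1) k fg(2) uv(1), of "[]"] w v' by simp
    moreover have "kstep k (whisker [] f ?v) = Some (whisker [] f v')"
      using kstep_whisker_right[OF v'(1) _ k fg(1) _ uv(2), of "[]"] w v' by simp
    ultimately show ?thesis using g' fg by auto
  qed
  note ex = this
  have PI: "(single_step X (whisker [] f' (step_src X g')),
      single_step X (whisker (step_src X f') g' [])) \<in> Peiffer X"
    "(single_step X (whisker (step_src X f') g' []),
      single_step X (whisker [] f' (step_src X g'))) \<in> Peiffer X"
    if "f' \<in> steps X" "g' \<in> steps X" for f' g'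
    using that by (auto simp: Peiffer_def Let_def)
  from bfg show ?thesis
  proof
    assume "b = (single_step X (whisker [] f ?v), single_step X (whisker ?u g []))"
    note b'' = b'[unfolded this]
    show ?thesis
    proof (rule kbranching_single_step[OF k st _ b''])
      fix h h' assume h: "b' = (single_step X h, single_step X h')"
        "K k (step_src X (whisker [] f ?v)) = Some (step_src X h)"
        "kstep k (whisker [] f ?v) = Some h" "kstep k (whisker ?u g []) = Some h'"
      then show ?thesis using ex[of "step_src X h"] PI(1) src by auto
    qed (simp add: src)
  next
    assume "b = (single_step X (whisker ?u g []), single_step X (whisker [] f ?v))"
    note b'' = b'[unfolded this]
    show ?thesis
    proof (rule kbranching_single_step[OF k st(2,1) _ b''])
      fix h h' assume h: "b' = (single_step X h, single_step X h')"
        "K k (step_src X (whisker ?u g [])) = Some (step_src X h)"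
        "kstep k (whisker ?u g []) = Some h" "kstep k (whisker [] f ?v) = Some h'"
      then show ?thesis using ex[of "step_src X h"] PI(2) src by auto
    qed (simp add: src)
  qed
qed

end

text \<open>Closing the previous context generalises its lemmas over the operator and the branching,
  as the premise of \<open>kbranching_invariant\<close> requires.\<close>

context
  fixes k b b'
  assumes inst: "k \<in> kashiwara_ops D" "b \<in> Br X" "kbranching k b = Some b'"
begin

lemma LBr_invariant: "b \<in> LBr X \<longleftrightarrow> b' \<in> LBr X"
  by (rule kbranching_invariant[OF _ inst], rule LBr_invariant_forward)

lemma Confl_invariant: "b \<in> Confl X \<longleftrightarrow> b' \<in> Confl X"
  by (rule kbranching_invariant[OF _ inst], rule Confl_invariant_forward)

lemma Aspherical_invariant: "b \<in> Aspherical X \<longleftrightarrow> b' \<in> Aspherical X"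
  by (rule kbranching_invariant[OF _ inst], rule Aspherical_invariant_forward)

lemma Peiffer_invariant: "b \<in> Peiffer X \<longleftrightarrow> b' \<in> Peiffer X"
  by (rule kbranching_invariant[OF _ inst], rule Peiffer_invariant_forward)

lemma Overlapping_invariant: "b \<in> Overlapping X \<longleftrightarrow> b' \<in> Overlapping X"
  using LBr_invariant Aspherical_invariant Peiffer_invariant by (simp add: Overlapping_def)

end

section \<open>Context order and critical branchings\<close>

lemma whisker_whisker: "whisker u' (whisker u f v) v' = whisker (u' @ u) f (v @ v')"
  by (simp add: whisker_def split: prod.splits)

lemma whisker_Nil [simp]: "whisker [] f [] = f"
  by (simp add: whisker_def split: prod.splits)

lemma whisker_eq_self: "f = whisker u f v \<Longrightarrow> u = [] \<and> v = []"
  by (cases f) (simp add: whisker_def)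

text \<open>A single generating comparison suffices, since whiskerings compose.\<close>

lemma context_orderE:
  assumes "(b, b') \<in> context_order X"
  obtains "b = b'"
  | f g u v where "b = (single_step X f, single_step X g)"
    "b' = (single_step X (whisker u f v), single_step X (whisker u g v))"
    "u \<in> words" "v \<in> words"
proof -
  have "b = b' \<or> (\<exists>f g u v. b = (single_step X f, single_step X g) \<and>
    b' = (single_step X (whisker u f v), single_step X (whisker u g v)) \<and> u \<in> words \<and> v \<in> words)"
    using assms unfolding context_order_def
  proof (induction rule: rtrancl_induct)
    case (step c c')
    from step(2) obtain f g u v where 1: "c = (single_step X f, single_step X g)"
      "c' = (single_step X (whisker u f v), single_step X (whisker u g v))" "u \<in> words" "v \<in> words"
      by blast
    from step(3) show ?case
    proof (elim disjE exE conjE)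
      fix f' g' u' v' assume 2: "b = (single_step X f', single_step X g')"
        "c = (single_step X (whisker u' f' v'), single_step X (whisker u' g' v'))"
        "u' \<in> words" "v' \<in> words"
      have "c' = (single_step X (whisker (u @ u') f' (v' @ v)),
          single_step X (whisker (u @ u') g' (v' @ v)))"
        using 1 2 by (auto simp: whisker_whisker[symmetric])
      then show ?case using 1 2 append_in_lists_conv by blast
    qed (use 1 in blast)
  qed simp
  then show thesis using that by blast
qed

lemma context_orderI:
  assumes "(single_step X f, single_step X g) \<in> LBr X" "u \<in> words" "v \<in> words"
  shows "((single_step X f, single_step X g),
    (single_step X (whisker u f v), single_step X (whisker u g v))) \<in> context_order X"
  unfolding context_order_def using assms by blast

text \<open>A branching \<open>c\<close> below \<open>b'\<close> is \<open>b'\<close> with contexts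
  \<open>u\<close>, \<open>v\<close> removed. Under the opposite operator either a context changes,
  and then \<open>c\<close> itself lies below \<open>b\<close>, or the inner pair changes, and then
  its image does. Minimality of \<open>b\<close> then makes a step equal to its own whiskering,
  which is possible only with empty contexts.\<close>

lemma Crit_invariant_forward:
  assumes k: "k \<in> kashiwara_ops D" and b: "b \<in> Br X" and b': "kbranching k b = Some b'"
    and crit: "b \<in> Crit X"
  shows "b' \<in> Crit X"
proof -
  have min: "c = b" if "c \<in> LBr X" "(c, b) \<in> context_order X" for c
    using crit that by (simp add: Crit_def)
  have "c = b'" if c: "c \<in> LBr X" and le: "(c, b') \<in> context_order X" for c
    using le
  proof (cases rule: context_orderE)
    case (2 f g u v)
    let ?k = "kinv k"
    have k': "?k \<in> kashiwara_ops D" using k by simp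
    have fg: "f \<in> steps X" "g \<in> steps X" "step_src X f = step_src X g"
      using c 2(1) by (auto elim: LBrE)
    have st: "whisker u f v \<in> steps X" "whisker u g v \<in> steps X"
      "step_src X (whisker u f v) = step_src X (whisker u g v)"
      using whisker_steps fg 2 by (simp_all add: step_src_whisker)
    obtain h h' where h: "b = (single_step X h, single_step X h')"
      "K ?k (step_src X (whisker u f v)) = Some (step_src X h)"
      "kstep ?k (whisker u f v) = Some h" "kstep ?k (whisker u g v) = Some h'"
      by (rule kbranching_single_step[OF k' st, of b])
        (use kbranching_inverse(2)[OF k b b'] 2(2) in auto)
    have w: "K ?k (u @ step_src X f @ v) = Some (step_src X h)"
      using h(2) by (simp add: step_src_whisker)
    have "u = [] \<and> v = []"
      using k' 2(3) step_words(1)[OF fg(1)] 2(4) w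
    proof (cases rule: K_append3_cases)
      case (left u')
      note u' = K_closed[OF k' 2(3) left(1)] K_length[OF k' 2(3) left(1)]
      have b_eq: "b = (single_step X (whisker u' f v), single_step X (whisker u' g v))"
        using kstep_whisker_left[OF left(1) _ k' _ 2(3,4)] fg w left(2) h by simp
      then have "c = b" using min[OF c] c context_orderI[OF _ u'(1) 2(4), of f g] 2(1) b_eq by simp
      then have "f = whisker u' f v" using 2(1) b_eq by simp
      \<comment> \<open>Minimality makes the changed context \<open>u'\<close> empty; operators
        preserve length, so \<open>u\<close> is empty too.\<close>
      then show ?thesis using whisker_eq_self u' by fastforce
    next
      case (middle s')
      obtain f' where f': "kstep ?k f = Some f'" "f' \<in> steps X" "step_src X f' = s'"
        using kstep_exists[OF k' fg(1) middle(1)] by metis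
      obtain g' where g': "kstep ?k g = Some g'" "g' \<in> steps X" "step_src X g' = s'"
        using kstep_exists[OF k' fg(2)] middle(1) fg(3) by metis
      have b_eq: "b = (single_step X (whisker u f' v), single_step X (whisker u g' v))"
        using kstep_whisker_middle[OF f'(1) _ middle(1) k' fg(1) 2(3,4)]
          kstep_whisker_middle[OF g'(1) _ _ k' fg(2) 2(3,4)] fg(3) w middle(1,2) h by simp
      have "(single_step X f', single_step X g') \<in> LBr X" using LBrI f' g' by simp
      then have "(single_step X f', single_step X g') = b"
        using min[of "(single_step X f', single_step X g')"] context_orderI[OF _ 2(3,4), of f' g']
        unfolding b_eq by blast
      then show ?thesis using b_eq whisker_eq_self[of f' u v] by simp
    next
      case (right v')
      note v' = K_closed[OF k' 2(4) right(1)] K_length[OF k' 2(4) right(1)]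
      have b_eq: "b = (single_step X (whisker u f v'), single_step X (whisker u g v'))"
        using kstep_whisker_right[OF right(1) _ k' _ 2(3,4)] fg w right(2) h by simp
      then have "c = b" using min[OF c] c context_orderI[OF _ 2(3) v'(1), of f g] 2(1) b_eq by simp
      then have "f = whisker u f v'" using 2(1) b_eq by simp
      then show ?thesis using whisker_eq_self v' by fastforce
    qed
    then show ?thesis using 2 by simp
  qed
  then show ?thesis
    using crit Overlapping_invariant[OF k b b'] by (simp add: Crit_def)
qed

lemma Crit_invariant:
  assumes "k \<in> kashiwara_ops D" "b \<in> Br X" "kbranching k b = Some b'"
  shows "b \<in> Crit X \<longleftrightarrow> b' \<in> Crit X"
  by (rule kbranching_invariant[OF _ assms], rule Crit_invariant_forward)

end

theorem proposition3p2p4: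
  fixes D :: "('i, 'p::ab_group_add) cartan_datum"
    and X :: "('a, 'b) polygraph"
    and \<Gamma>\<^sub>1 :: "('a, 'i, 'p) crystal"
    and \<Gamma>\<^sub>2 :: "('b, 'i, 'p) crystal"
    and \<alpha> \<beta> :: "('a, 'b) rseq"
    and k :: "'i kashiwara"
    and kb :: "('a, 'b) branching"
  assumes "kac_moody_datum D"
    and "crystal_polygraph D X \<Gamma>\<^sub>1 \<Gamma>\<^sub>2"
    and "(\<alpha>, \<beta>) \<in> Br X"
    and "k \<in> kashiwara_ops D"
    and "kact_branching X \<Gamma>\<^sub>1 \<Gamma>\<^sub>2 k (\<alpha>, \<beta>) = Some kb"
  shows "((\<alpha>, \<beta>) \<in> LBr X \<longleftrightarrow> kb \<in> LBr X) \<and>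
    ((\<alpha>, \<beta>) \<in> Confl X \<longleftrightarrow> kb \<in> Confl X) \<and>
    ((\<alpha>, \<beta>) \<in> Aspherical X \<longleftrightarrow> kb \<in> Aspherical X) \<and>
    ((\<alpha>, \<beta>) \<in> Peiffer X \<longleftrightarrow> kb \<in> Peiffer X) \<and>
    ((\<alpha>, \<beta>) \<in> Overlapping X \<longleftrightarrow> kb \<in> Overlapping X) \<and>
    ((\<alpha>, \<beta>) \<in> Crit X \<longleftrightarrow> kb \<in> Crit X)"
proof -
  interpret crystal_2polygraph D X \<Gamma>\<^sub>1 \<Gamma>\<^sub>2
    using assms(2) by (rule crystal_2polygraph.intro)
  note a = assms(4,3,5)
  show ?thesis
    using LBr_invariant[OF a] Confl_invariant[OF a] Aspherical_invariant[OF a]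
      Peiffer_invariant[OF a] Overlapping_invariant[OF a] Crit_invariant[OF a] by blast
qed

end
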